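(* Let $G$ be a compact Hausdorff topological group and let $\alpha$ be a (not necessarily continuous) automorphism of $G$ such that $\alpha^3=1$ and the set $X=\{x\in G : x^{\alpha^2}x^{\alpha}x=1\}$ is measurable. If $X$ has positive Haar measure, then $G$ contains an open normal $2$-Engel subgroup.
   Context: An automorphism of $G$ here means an automorphism of the underlying abstract group; $x^{\alpha}$ denotes the image of $x$ under $\alpha$, $x^{\alpha^2}=(x^{\alpha})^{\alpha}$, and $\alpha^3=1$ means that the third iterate of $\alpha$ is the identity automorphism. Measurability and measure are with respect to the normalized Haar measure of $G$. With $[a,b]=a^{-1}b^{-1}ab$ and $[a,b,c]=[[a,b],c]$, a group $H$ is $2$-Engel if $[a,b,b]=1$ for all $a,b\in H$. *)

theory Defs
  imports "HOL-Analysis.Analysis" "HOL-Algebra.Coset"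
begin

locale topological_group = group G for G (structure) +
  fixes T :: "'a topology"
  assumes topspace_eq_carrier: "topspace T = carrier G"
    and continuous_mult: "continuous_map (prod_topology T T) T (\<lambda>(x, y). x \<otimes> y)"
    and continuous_inv: "continuous_map T T (\<lambda>x. inv x)"

definition borel_of :: "'a topology \<Rightarrow> 'a measure" where
  "borel_of T = sigma (topspace T) {U. openin T U}"

text \<open>
  The normalized Haar measure of a compact Hausdorff group is its unique regular, left-invariant
  Borel probability measure. It is characterized here on the Borel sets. The Haar measurable sets
  are the measurable sets of its completion.
\<close>

definition normalized_haar_measure ::
  "('a, 'b) monoid_scheme \<Rightarrow> 'a topology \<Rightarrow> 'a measure \<Rightarrow> bool" where
  "normalized_haar_measure G T M \<longleftrightarrow>
     sets M = sets (borel_of T) \<and>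
     emeasure M (space M) = 1 \<and>
     (\<forall>g\<in>carrier G. \<forall>A\<in>sets M. emeasure M (g <#\<^bsub>G\<^esub> A) = emeasure M A) \<and>
     (\<forall>A\<in>sets M. emeasure M A = (INF U\<in>{U. openin T U \<and> A \<subseteq> U}. emeasure M U)) \<and>
     (\<forall>U. openin T U \<longrightarrow>
        emeasure M U = (SUP K\<in>{K. compactin T K \<and> K \<subseteq> U}. emeasure M K))"

definition commutator :: "('a, 'b) monoid_scheme \<Rightarrow> 'a \<Rightarrow> 'a \<Rightarrow> 'a" where
  "commutator G a b = inv\<^bsub>G\<^esub> a \<otimes>\<^bsub>G\<^esub> inv\<^bsub>G\<^esub> b \<otimes>\<^bsub>G\<^esub> a \<otimes>\<^bsub>G\<^esub> b"

definition two_engel :: "('a, 'b) monoid_scheme \<Rightarrow> bool" where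
  "two_engel H \<longleftrightarrow>
     group H \<and>
     (\<forall>a\<in>carrier H. \<forall>b\<in>carrier H. commutator H (commutator H a b) b = \<one>\<^bsub>H\<^esub>)"

end

(*
  In the semidirect product of G with <alpha> the equation defining S reads (alpha x)^3 = 1. A set
  of positive measure meets finitely many of its translates by elements near the identity in a
  common point, so for a and b near 1 some element t of the coset of alpha satisfies (t w)^3 = 1
  for all of the words w = 1, a, b, b^-1, ab, a^-1 b, b^-1 a, b^-1 a^-1. This forces a to commute
  with its conjugate a^b: by the cubes, a commutes with a^s for s = t b^-1 and for s = b t, so a^b
  commutes with a^t and with a^(t^2), and a is the inverse of a^(t^2) a^t.

  Hence the 2-Engel law holds for all words of bounded length in a neighbourhood U of 1. The proof of
  Levi's theorem that 2-Engel groups have class at most 3 uses only words of bounded length, so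
  [x, b, c, d] = 1 on U. Commutator identities on generators then pass to the subgroup generated
  by U, which is open, nilpotent of class at most 3, and 2-Engel by trilinearity of [x, y, z].
*)

theory Submission
  imports Defs "HOL-Algebra.Generated_Groups"
begin

section \<open>Conjugates and commutators in an arbitrary group\<close>

definition conj_by :: "('a, 'b) monoid_scheme \<Rightarrow> 'a \<Rightarrow> 'a \<Rightarrow> 'a" where
  "conj_by G x g = inv\<^bsub>G\<^esub> g \<otimes>\<^bsub>G\<^esub> x \<otimes>\<^bsub>G\<^esub> g"

context group
begin

lemma inv_mult_cancel_left: "x \<in> carrier G \<Longrightarrow> y \<in> carrier G \<Longrightarrow> inv x \<otimes> (x \<otimes> y) = y"
  by (simp add: m_assoc [symmetric])

lemma mult_inv_cancel_left: "x \<in> carrier G \<Longrightarrow> y \<in> carrier G \<Longrightarrow> x \<otimes> (inv x \<otimes> y) = y"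
  by (simp add: m_assoc [symmetric])

lemmas word_simps = m_assoc inv_mult_group inv_mult_cancel_left mult_inv_cancel_left

lemma conj_by_closed [simp, intro]:
  "x \<in> carrier G \<Longrightarrow> g \<in> carrier G \<Longrightarrow> conj_by G x g \<in> carrier G"
  by (simp add: conj_by_def)

lemma commutator_closed [simp, intro]:
  "x \<in> carrier G \<Longrightarrow> g \<in> carrier G \<Longrightarrow> commutator G x g \<in> carrier G"
  by (simp add: commutator_def)

lemma commutator_eq_conj_by:
  "x \<in> carrier G \<Longrightarrow> g \<in> carrier G \<Longrightarrow> commutator G x g = inv x \<otimes> conj_by G x g"
  by (simp add: conj_by_def commutator_def word_simps)

lemma conj_by_mult:
  "x \<in> carrier G \<Longrightarrow> y \<in> carrier G \<Longrightarrow> g \<in> carrier G \<Longrightarrow>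
    conj_by G (x \<otimes> y) g = conj_by G x g \<otimes> conj_by G y g"
  by (simp add: conj_by_def word_simps)

lemma conj_by_inv:
  "x \<in> carrier G \<Longrightarrow> g \<in> carrier G \<Longrightarrow> conj_by G (inv x) g = inv (conj_by G x g)"
  by (simp add: conj_by_def word_simps)

lemma conj_by_conj_by:
  "x \<in> carrier G \<Longrightarrow> g \<in> carrier G \<Longrightarrow> h \<in> carrier G \<Longrightarrow>
    conj_by G (conj_by G x g) h = conj_by G x (g \<otimes> h)"
  by (simp add: conj_by_def word_simps)

lemma conj_by_one [simp]: "x \<in> carrier G \<Longrightarrow> conj_by G x \<one> = x"
  "g \<in> carrier G \<Longrightarrow> conj_by G \<one> g = \<one>"
  by (simp_all add: conj_by_def)

lemma inv_commutator:
  "x \<in> carrier G \<Longrightarrow> y \<in> carrier G \<Longrightarrow> inv (commutator G x y) = commutator G y x"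
  by (simp add: commutator_def word_simps)

text \<open>Here and in the next lemma the conjugate of the usual expansion is split into a
  commutator and one of higher weight, so that products can be expanded weight by weight.\<close>

lemma commutator_mult_right:
  "x \<in> carrier G \<Longrightarrow> y \<in> carrier G \<Longrightarrow> z \<in> carrier G \<Longrightarrow>
    commutator G x (y \<otimes> z) =
      commutator G x z \<otimes> commutator G x y \<otimes> commutator G (commutator G x y) z"
  by (simp add: commutator_def word_simps)

lemma commutator_mult_left:
  "x \<in> carrier G \<Longrightarrow> y \<in> carrier G \<Longrightarrow> z \<in> carrier G \<Longrightarrow>
    commutator G (x \<otimes> y) z =
      commutator G x z \<otimes> commutator G (commutator G x z) y \<otimes> commutator G y z"
  by (simp add: commutator_def word_simps)

lemma commutator_eq_one_iff:
  assumes "x \<in> carrier G" "y \<in> carrier G"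
  shows "commutator G x y = \<one> \<longleftrightarrow> x \<otimes> y = y \<otimes> x"
proof -
  have "commutator G x y = inv (y \<otimes> x) \<otimes> (x \<otimes> y)"
    using assms by (simp add: commutator_def word_simps)
  then show ?thesis
    using assms by (metis inv_closed inv_equality inv_inv l_inv m_closed)
qed

lemma hall_witt:
  assumes "x \<in> carrier G" "y \<in> carrier G" "z \<in> carrier G"
  shows "conj_by G (commutator G (commutator G x (inv y)) z) y \<otimes>
    conj_by G (commutator G (commutator G y (inv z)) x) z \<otimes>
    conj_by G (commutator G (commutator G z (inv x)) y) x = \<one>"
  using assms by (simp add: commutator_def conj_by_def word_simps)

lemma commute_inv:
  assumes "x \<otimes> y = y \<otimes> x" "x \<in> carrier G" "y \<in> carrier G"
  shows "x \<otimes> inv y = inv y \<otimes> x"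
  using assms by (metis inv_closed inv_solve_left inv_solve_right m_assoc m_closed)

lemma conj_by_eq_self_iff:
  assumes "x \<in> carrier G" "g \<in> carrier G"
  shows "conj_by G x g = x \<longleftrightarrow> x \<otimes> g = g \<otimes> x"
  using assms unfolding conj_by_def
  by (metis inv_closed inv_solve_left m_assoc m_closed)

lemma commute_conj_by:
  assumes "x \<otimes> y = y \<otimes> x" "x \<in> carrier G" "y \<in> carrier G" "g \<in> carrier G"
  shows "conj_by G x g \<otimes> conj_by G y g = conj_by G y g \<otimes> conj_by G x g"
  using assms by (metis conj_by_mult)

text \<open>A centralizer is a subgroup: the first induction moves \<open>q\<close> from
  \<open>S\<close> to the generated subgroup, the second moves \<open>p\<close>.\<close>

lemma generate_commute:
  assumes "S \<subseteq> carrier G"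
    and comm: "\<And>x y. x \<in> S \<Longrightarrow> y \<in> S \<Longrightarrow> x \<otimes> y = y \<otimes> x"
    and p: "p \<in> generate G S" and q: "q \<in> generate G S"
  shows "p \<otimes> q = q \<otimes> p"
proof -
  have carr: "r \<in> carrier G" if "r \<in> generate G S" for r
    using generate_in_carrier [OF assms(1) that] .
  have one: "x \<otimes> q = q \<otimes> x" if x: "x \<in> S" for x
    using q
  proof induction
    case one then show ?case using assms(1) x by auto
  next
    case (incl h) then show ?case using comm x by blast
  next
    case (inv h)
    then show ?case using commute_inv comm x assms(1) by blast
  next
    case (eng h1 h2)
    have c: "h1 \<in> carrier G" "h2 \<in> carrier G" "x \<in> carrier G"
      using eng carr x assms(1) by auto
    show ?case using eng.IH c by (metis m_assoc)
  qed
  show ?thesis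
    using p
  proof induction
    case one then show ?case using carr q by auto
  next
    case (incl h) then show ?case using one by blast
  next
    case (inv h)
    then show ?case using commute_inv one carr q assms(1) by (metis subsetD)
  next
    case (eng h1 h2)
    have c: "h1 \<in> carrier G" "h2 \<in> carrier G" "q \<in> carrier G"
      using eng carr q by auto
    show ?case using eng.IH c by (metis m_assoc)
  qed
qed

end

section \<open>Consequences of the 2-Engel law for words of bounded length\<close>

text \<open>
  \<open>B n\<close> plays the role of the words of length at most \<open>n\<close>; 16 is the length that the arguments
  below need when they start from four elements of \<open>B 1\<close>.
\<close>

locale engel_filtration = group G for G (structure) +
  fixes B :: "nat \<Rightarrow> 'a set"
  assumes filt_closed: "\<And>n. B n \<subseteq> carrier G"
    and filt_mono: "\<And>m n. m \<le> n \<Longrightarrow> B m \<subseteq> B n"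
    and filt_mult: "\<And>m n x y. x \<in> B m \<Longrightarrow> y \<in> B n \<Longrightarrow> x \<otimes> y \<in> B (m + n)"
    and filt_inv: "\<And>n x. x \<in> B n \<Longrightarrow> inv x \<in> B n"
    and filt_one: "\<one> \<in> B 0"
    and commute_conj: "\<And>x g. x \<in> B 16 \<Longrightarrow> g \<in> B 16 \<Longrightarrow> x \<otimes> conj_by G x g = conj_by G x g \<otimes> x"
begin

abbreviation cj where "cj \<equiv> conj_by G"
abbreviation cm where "cm \<equiv> commutator G"

lemma filt_carrier: "x \<in> B n \<Longrightarrow> x \<in> carrier G"
  using filt_closed by (rule subsetD)

lemma filt_le: "x \<in> B m \<Longrightarrow> m \<le> n \<Longrightarrow> x \<in> B n"
  by (erule subsetD [OF filt_mono, rotated])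

lemma filt_conj: "x \<in> B m \<Longrightarrow> g \<in> B n \<Longrightarrow> cj x g \<in> B (m + 2 * n)"
  unfolding conj_by_def by (rule filt_le [OF filt_mult [OF filt_mult [OF filt_inv]]]) auto

lemma filt_commutator: "x \<in> B m \<Longrightarrow> y \<in> B n \<Longrightarrow> cm x y \<in> B (2 * m + 2 * n)"
  unfolding commutator_def
  by (rule filt_le [OF filt_mult [OF filt_mult [OF filt_mult [OF filt_inv filt_inv]]]]) auto

lemma conj_image_subset: "x \<in> carrier G \<Longrightarrow> cj x ` B k \<subseteq> carrier G"
  by (rule image_subsetI) (rule conj_by_closed [OF _ filt_carrier])

text \<open>A bounded substitute for the normal closure of \<open>x\<close>, which is abelian in a
  2-Engel group. The index keeps track of the length of the conjugating words, because the law is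
  available only up to a fixed length.\<close>

definition conj_span :: "'a \<Rightarrow> nat \<Rightarrow> 'a set" where
  "conj_span x k = generate G (cj x ` B k)"

lemma conj_span_subgroup: "x \<in> carrier G \<Longrightarrow> subgroup (conj_span x k) G"
  unfolding conj_span_def by (rule generate_is_subgroup [OF conj_image_subset])

lemma conj_span_carrier: "x \<in> carrier G \<Longrightarrow> p \<in> conj_span x k \<Longrightarrow> p \<in> carrier G"
  by (rule subgroup.mem_carrier [OF conj_span_subgroup])

lemma conj_span_mult:
  "x \<in> carrier G \<Longrightarrow> p \<in> conj_span x k \<Longrightarrow> q \<in> conj_span x k \<Longrightarrow> p \<otimes> q \<in> conj_span x k"
  by (rule subgroup.m_closed [OF conj_span_subgroup])

lemma conj_span_inv:
  "x \<in> carrier G \<Longrightarrow> p \<in> conj_span x k \<Longrightarrow> inv p \<in> conj_span x k"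
  by (rule subgroup.m_inv_closed [OF conj_span_subgroup])

lemma conj_span_base: "g \<in> B k \<Longrightarrow> cj x g \<in> conj_span x k"
  unfolding conj_span_def by (blast intro: generate.incl)

lemma conj_span_self: "x \<in> carrier G \<Longrightarrow> x \<in> conj_span x k"
  using conj_span_base [OF filt_le [OF filt_one le0], of x k] by simp

lemma conj_span_mono: "k \<le> l \<Longrightarrow> conj_span x k \<subseteq> conj_span x l"
  unfolding conj_span_def by (rule mono_generate [OF image_mono [OF filt_mono]])

text \<open>Conjugating \<open>cj x u\<close> by \<open>g\<close> gives
  \<open>cj x (u \<otimes> g)\<close>, so the length bound grows by that of
  \<open>g\<close>.\<close>

lemma conj_span_conj:
  assumes "x \<in> carrier G" "p \<in> conj_span x k" "g \<in> B m"
  shows "cj p g \<in> conj_span x (k + m)"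
  using assms(2) unfolding conj_span_def
proof (induction)
  case one then show ?case using filt_carrier [OF assms(3)] by (simp add: generate.one)
next
  case (incl h)
  then obtain u where u: "u \<in> B k" "h = cj x u" by auto
  then have "cj h g = cj x (u \<otimes> g)"
    using assms(1) filt_carrier [OF u(1)] filt_carrier [OF assms(3)] by (simp add: conj_by_conj_by)
  then show ?case using filt_mult [OF u(1) assms(3)] by (auto intro: generate.incl)
next
  case (inv h)
  then obtain u where u: "u \<in> B k" "h = cj x u" by auto
  then have "cj (inv h) g = inv (cj x (u \<otimes> g))"
    using assms(1) filt_carrier [OF u(1)] filt_carrier [OF assms(3)]
    by (simp add: conj_by_conj_by conj_by_inv)
  then show ?case using filt_mult [OF u(1) assms(3)] by (auto intro: generate.inv)
next
  case (eng h1 h2)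
  have "h1 \<in> carrier G" "h2 \<in> carrier G"
    using eng.hyps conj_span_carrier [OF assms(1), unfolded conj_span_def] by auto
  then have "cj (h1 \<otimes> h2) g = cj h1 g \<otimes> cj h2 g"
    using filt_carrier [OF assms(3)] by (rule conj_by_mult)
  then show ?case using generate.eng [OF eng.IH] by simp
qed

lemma conj_span_commutator:
  assumes "x \<in> carrier G" "p \<in> conj_span x k" "g \<in> B m"
  shows "cm p g \<in> conj_span x (k + m)"
proof -
  have "p \<in> carrier G" "g \<in> carrier G"
    using conj_span_carrier [OF assms(1,2)] filt_carrier [OF assms(3)] .
  then have "cm p g = inv p \<otimes> cj p g" by (rule commutator_eq_conj_by)
  moreover have "p \<in> conj_span x (k + m)" using assms(2) conj_span_mono [of k "k + m" x] by auto
  ultimately show ?thesis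
    using conj_span_mult [OF assms(1) conj_span_inv [OF assms(1)] conj_span_conj [OF assms]] by metis
qed

text \<open>The conjugates of \<open>x\<close> by \<open>g\<close> and \<open>h\<close> commute if
  \<open>x\<close> commutes with its conjugate by \<open>h \<otimes> inv g\<close>. This word has
  length at most 2k, hence the bound 8.\<close>

lemma conj_span_commute:
  assumes "x \<in> B 16" "k \<le> 8" "p \<in> conj_span x k" "q \<in> conj_span x k"
  shows "p \<otimes> q = q \<otimes> p"
proof (rule generate_commute)
  show "cj x ` B k \<subseteq> carrier G" by (rule conj_image_subset [OF filt_carrier [OF assms(1)]])
  show "p \<in> generate G (cj x ` B k)" "q \<in> generate G (cj x ` B k)"
    using assms unfolding conj_span_def by auto
  fix y z assume "y \<in> cj x ` B k" "z \<in> cj x ` B k"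
  then obtain g h where gh: "g \<in> B k" "h \<in> B k" "y = cj x g" "z = cj x h" by auto
  have "h \<otimes> inv g \<in> B 16"
    using filt_le [OF filt_mult [OF gh(2) filt_inv [OF gh(1)]], of 16] assms(2) by simp
  then have "x \<otimes> cj x (h \<otimes> inv g) = cj x (h \<otimes> inv g) \<otimes> x" by (rule commute_conj [OF assms(1)])
  moreover have c: "x \<in> carrier G" "g \<in> carrier G" "h \<in> carrier G"
    using gh assms filt_carrier by blast+
  ultimately have "cj x g \<otimes> cj (cj x (h \<otimes> inv g)) g = cj (cj x (h \<otimes> inv g)) g \<otimes> cj x g"
    by (intro commute_conj_by) auto
  then show "y \<otimes> z = z \<otimes> y"
    using c gh by (simp add: conj_by_conj_by word_simps)
qed

text \<open>The commutator is the inverse of \<open>cj h x\<close> times \<open>h\<close>, and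
  \<open>h\<close> commutes with its own conjugate.\<close>

lemma engel:
  assumes "x \<in> B 16" "h \<in> B 16"
  shows "cm x h \<otimes> h = h \<otimes> cm x h"
proof -
  have c: "x \<in> carrier G" "h \<in> carrier G" using assms filt_carrier by blast+
  have eq: "cm x h = inv (cj h x) \<otimes> h" using c by (simp add: commutator_def conj_by_def word_simps)
  have "h \<otimes> inv (cj h x) = inv (cj h x) \<otimes> h"
    using commute_inv [OF commute_conj [OF assms(2,1)]] c by simp
  then have "(inv (cj h x) \<otimes> h) \<otimes> h = (h \<otimes> inv (cj h x)) \<otimes> h" by simp
  then show ?thesis unfolding eq using c by (simp add: m_assoc)
qed

text \<open>By \<open>engel\<close>, conjugation by \<open>inv h\<close> fixes
  \<open>cm x h\<close>. Writing both sides in conjugates of \<open>x\<close> gives the relation,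
  which in additive operator notation is h^-1 + h = 2.\<close>

lemma conj_inv_mult_conj:
  assumes "x \<in> B 16" "h \<in> B 8"
  shows "cj x (inv h) \<otimes> cj x h = x \<otimes> x"
proof -
  have c: "x \<in> carrier G" "h \<in> carrier G" using assms filt_carrier by blast+
  have h: "h \<in> B 16" using filt_le [OF assms(2)] by simp
  have "cm x h \<otimes> inv h = inv h \<otimes> cm x h"
    using commute_inv [OF engel [OF assms(1) h]] c by simp
  then have "cj (cm x h) (inv h) = cm x h"
    using c by (simp add: conj_by_eq_self_iff)
  moreover have "cj (cm x h) (inv h) = inv (cj x (inv h)) \<otimes> x"
    using c by (simp add: conj_by_def commutator_def word_simps)
  ultimately have "inv (cj x (inv h)) \<otimes> x = inv x \<otimes> cj x h"
    using c by (simp add: commutator_eq_conj_by)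
  then have "x = cj x (inv h) \<otimes> (inv x \<otimes> cj x h)"
    using c mult_inv_cancel_left [of "cj x (inv h)" x] by simp
  then have "x \<otimes> x = x \<otimes> (cj x (inv h) \<otimes> (inv x \<otimes> cj x h))" by simp
  also have "\<dots> = (x \<otimes> cj x (inv h)) \<otimes> (inv x \<otimes> cj x h)" using c by (simp add: m_assoc)
  also have "\<dots> = (cj x (inv h) \<otimes> x) \<otimes> (inv x \<otimes> cj x h)"
    using commute_conj [OF assms(1) filt_inv [OF h]] by simp
  also have "\<dots> = cj x (inv h) \<otimes> cj x h" using c by (simp add: word_simps)
  finally show ?thesis by simp
qed

end

section \<open>Cancellation in abelian groups and inverses in commutators\<close>

text \<open>The letters stand for conjugates of \<open>x\<close>: by b, c, bc and cb for those so
  named, by (bc)^-1 for \<open>p\<close>, by c b^-1 for \<open>q\<close>, and by b^-1 for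
  \<open>r\<close>. Additively, eliminating p, q and r from the four equations leaves bc + cb + 2x =
  2b + 2c.\<close>

lemma (in comm_group) commutator_swap_relation:
  assumes "x \<in> carrier G" "b \<in> carrier G" "c \<in> carrier G" "bc \<in> carrier G" "cb \<in> carrier G"
    "p \<in> carrier G" "q \<in> carrier G" "r \<in> carrier G"
    and eqs: "p \<otimes> bc = x \<otimes> x" "p \<otimes> q = r \<otimes> r" "q \<otimes> cb = c \<otimes> c" "r \<otimes> b = x \<otimes> x"
  shows "inv (inv x \<otimes> b) \<otimes> (inv c \<otimes> bc) \<otimes> (inv (inv x \<otimes> c) \<otimes> (inv b \<otimes> cb)) = \<one>"
proof -
  note c = assms(1-8)
  have "(r \<otimes> r) \<otimes> (bc \<otimes> cb) = (p \<otimes> bc) \<otimes> (q \<otimes> cb)"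
    unfolding eqs(2) [symmetric] using c by (simp add: m_ac)
  then have 1: "(r \<otimes> r) \<otimes> (bc \<otimes> cb) = (x \<otimes> x) \<otimes> (c \<otimes> c)" by (simp add: eqs)
  have "(x \<otimes> x) \<otimes> (bc \<otimes> cb \<otimes> (x \<otimes> x)) = (bc \<otimes> cb) \<otimes> ((r \<otimes> b) \<otimes> (r \<otimes> b))"
    unfolding eqs(4) using c by (simp add: m_ac)
  also have "\<dots> = ((r \<otimes> r) \<otimes> (bc \<otimes> cb)) \<otimes> (b \<otimes> b)" using c by (simp add: m_ac)
  also have "\<dots> = (x \<otimes> x) \<otimes> ((c \<otimes> c) \<otimes> (b \<otimes> b))" unfolding 1 using c by (simp add: m_ac)
  finally have 2: "bc \<otimes> cb \<otimes> (x \<otimes> x) = (c \<otimes> c) \<otimes> (b \<otimes> b)" using c by simp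
  have "inv (inv x \<otimes> b) \<otimes> (inv c \<otimes> bc) \<otimes> (inv (inv x \<otimes> c) \<otimes> (inv b \<otimes> cb))
      = inv ((c \<otimes> c) \<otimes> (b \<otimes> b)) \<otimes> (bc \<otimes> cb \<otimes> (x \<otimes> x))"
    using c by (simp add: m_ac inv_mult)
  then show ?thesis unfolding 2 using c by simp
qed

text \<open>Isolates the two commutators of weight four when the swap relation is expanded at a
  product.\<close>

lemma (in comm_group) six_factor_cancel:
  assumes "a \<in> carrier G" "a' \<in> carrier G" "e \<in> carrier G" "e' \<in> carrier G"
    "f \<in> carrier G" "f' \<in> carrier G"
    and "a \<otimes> a' = \<one>" "e \<otimes> e' = \<one>" "a \<otimes> e \<otimes> f \<otimes> (a' \<otimes> e' \<otimes> f') = \<one>"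
  shows "f \<otimes> f' = \<one>"
proof -
  have "a \<otimes> e \<otimes> f \<otimes> (a' \<otimes> e' \<otimes> f') = (a \<otimes> a') \<otimes> (e \<otimes> e') \<otimes> (f \<otimes> f')"
    using assms(1-6) by (simp add: m_ac)
  then show ?thesis using assms by simp
qed

text \<open>The two sides are the products of \<open>u\<close> and the inverse of its conjugate in
  the two possible orders.\<close>

lemma (in group) commutator_inv_left:
  assumes "u \<in> carrier G" "g \<in> carrier G" "u \<otimes> conj_by G u g = conj_by G u g \<otimes> u"
  shows "commutator G (inv u) g = inv (commutator G u g)"
proof -
  have "commutator G (inv u) g = u \<otimes> inv (conj_by G u g)"
    using assms(1,2) by (simp add: commutator_eq_conj_by conj_by_inv)
  also have "\<dots> = inv (conj_by G u g) \<otimes> u" using commute_inv [OF assms(3)] assms(1,2) by simp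
  finally show ?thesis using assms(1,2) by (simp add: commutator_eq_conj_by inv_mult_group)
qed

section \<open>Levi's theorem for words of bounded length\<close>

context engel_filtration
begin

text \<open>Makes the bounded normal closure a group in its own right, so that the abelian
  identities above apply to it.\<close>

lemma conj_span_comm_group:
  assumes "x \<in> B 16" "k \<le> 8"
  shows "comm_group (G\<lparr>carrier := conj_span x k\<rparr>)"
proof -
  interpret H: group "G\<lparr>carrier := conj_span x k\<rparr>"
    by (rule subgroup_imp_group [OF conj_span_subgroup [OF filt_carrier [OF assms(1)]]])
  show ?thesis by (rule H.group_comm_groupI) (simp add: conj_span_commute [OF assms])
qed

lemma conj_span_inv_eq:
  "x \<in> carrier G \<Longrightarrow> p \<in> conj_span x k \<Longrightarrow> inv\<^bsub>G\<lparr>carrier := conj_span x k\<rparr>\<^esub> p = inv p"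
  by (rule m_inv_consistent [OF conj_span_subgroup])

text \<open>
  Writing \<open>b\<close> and \<open>c\<close> for their actions on the abelian group of conjugates of \<open>x\<close>, the law says
  \<open>h\<inverse> = 2 - h\<close>. Hence \<open>2 - bc = (bc)\<inverse> = c\<inverse> b\<inverse> = (2 - c)(2 - b)\<close>, that is,
  \<open>(b - 1)(c - 1) + (c - 1)(b - 1) = 0\<close>.
\<close>

lemma triple_commutator_swap_right:
  assumes "x \<in> B 4" "b \<in> B 4" "c \<in> B 4"
  shows "cm (cm x b) c \<otimes> cm (cm x c) b = \<one>"
proof -
  have x: "x \<in> B 16" and bc: "b \<otimes> c \<in> B 8" and cb: "c \<otimes> b \<in> B 8"
    and xc: "cj x c \<in> B 16" and b: "b \<in> B 8" and c: "c \<in> B 8"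
    using filt_le [OF assms(1)] filt_le [OF assms(2)] filt_le [OF assms(3)]
      filt_mult [OF assms(2,3)] filt_mult [OF assms(3,2)] filt_le [OF filt_conj [OF assms(1,3)]] by simp_all
  have car: "x \<in> carrier G" "b \<in> carrier G" "c \<in> carrier G" using assms filt_carrier by blast+
  have 1: "cj x (inv (b \<otimes> c)) \<otimes> cj x (b \<otimes> c) = x \<otimes> x" by (rule conj_inv_mult_conj [OF x bc])
  have 4: "cj x (inv b) \<otimes> cj x b = x \<otimes> x" by (rule conj_inv_mult_conj [OF x b])
  \<comment> \<open>The relation for \<open>b\<close>, applied to the conjugate
    \<open>cj x c\<close> in place of \<open>x\<close>.\<close>
  have "cj (cj x c) (inv b) \<otimes> cj (cj x c) b = cj x c \<otimes> cj x c"
    by (rule conj_inv_mult_conj [OF xc b])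
  then have 3: "cj x (c \<otimes> inv b) \<otimes> cj x (c \<otimes> b) = cj x c \<otimes> cj x c"
    using car by (simp add: conj_by_conj_by)
  \<comment> \<open>The relation for \<open>c\<close>, conjugated by \<open>inv b\<close>.\<close>
  have "cj (cj x (inv c) \<otimes> cj x c) (inv b) = cj (x \<otimes> x) (inv b)"
    using conj_inv_mult_conj [OF x c] by simp
  then have 2: "cj x (inv (b \<otimes> c)) \<otimes> cj x (c \<otimes> inv b) = cj x (inv b) \<otimes> cj x (inv b)"
    using car by (simp add: conj_by_conj_by conj_by_mult inv_mult_group)
  let ?S = "conj_span x 8"
  have S: "x \<in> ?S" "cj x b \<in> ?S" "cj x c \<in> ?S" "cj x (b \<otimes> c) \<in> ?S" "cj x (c \<otimes> b) \<in> ?S"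
    "cj x (inv (b \<otimes> c)) \<in> ?S" "cj x (c \<otimes> inv b) \<in> ?S" "cj x (inv b) \<in> ?S"
    using conj_span_self [OF car(1)] conj_span_base [OF b] conj_span_base [OF c]
      conj_span_base [OF bc] conj_span_base [OF cb] conj_span_base [OF filt_inv [OF bc]]
      conj_span_base [OF filt_inv [OF b]] conj_span_base [OF filt_mult [OF assms(3) filt_inv [OF assms(2)]]]
    by simp_all
  have "inv (inv x \<otimes> cj x b) \<otimes> (inv (cj x c) \<otimes> cj x (b \<otimes> c)) \<otimes>
      (inv (inv x \<otimes> cj x c) \<otimes> (inv (cj x b) \<otimes> cj x (c \<otimes> b))) = \<one>"
    using comm_group.commutator_swap_relation
        [OF conj_span_comm_group [OF x order_refl], simplified, OF S 1 2 3 4]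
    by (simp add: conj_span_inv_eq [OF car(1)] S conj_span_mult [OF car(1)] conj_span_inv [OF car(1)])
  then show ?thesis
    using car by (simp add: commutator_eq_conj_by conj_by_mult conj_by_inv conj_by_conj_by)
qed

lemma triple_commutator_swap_right_inv:
  assumes "x \<in> B 4" "b \<in> B 4" "c \<in> B 4"
  shows "cm (cm x c) b = inv (cm (cm x b) c)"
  using triple_commutator_swap_right [OF assms(1,3,2)] assms filt_carrier
  by (metis commutator_closed inv_equality)

lemma triple_commutator_swap_left:
  assumes "x \<in> B 4" "b \<in> B 4" "c \<in> B 16"
  shows "cm (cm b x) c = inv (cm (cm x b) c)"
proof -
  have car: "x \<in> carrier G" "b \<in> carrier G" "c \<in> carrier G" using assms filt_carrier by blast+
  have "cm x b \<in> B 16" using filt_le [OF filt_commutator [OF assms(1,2)]] by simp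
  then have "cm (inv (cm x b)) c = inv (cm (cm x b) c)"
    using car assms(3) by (intro commutator_inv_left commute_conj) auto
  then show ?thesis using car by (simp add: inv_commutator)
qed

lemma commutator_inv_right:
  assumes "x \<in> B 16" "y \<in> B 8"
  shows "cm x (inv y) = inv (cm x y)"
proof -
  have car: "x \<in> carrier G" "y \<in> carrier G" using assms filt_carrier by blast+
  have y: "y \<in> B 16" using filt_le [OF assms(2)] by simp
  have "cj x (inv y) \<otimes> cj x y = x \<otimes> x" by (rule conj_inv_mult_conj [OF assms])
  then have "cj x (inv y) = x \<otimes> x \<otimes> inv (cj x y)" using car by (simp add: inv_solve_right)
  then have "cm x (inv y) = x \<otimes> inv (cj x y)"
    using car by (simp add: commutator_eq_conj_by word_simps)
  also have "\<dots> = inv (cj x y) \<otimes> x" using commute_inv [OF commute_conj [OF assms(1) y]] car by simp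
  finally show ?thesis using car by (simp add: commutator_eq_conj_by inv_mult_group)
qed

text \<open>The swap relations make [y,z,x] and [z,x,y] equal to [x,y,z], and each factor of the
  Hall-Witt identity becomes the inverse of this element.\<close>

lemma triple_commutator_cube:
  assumes "x \<in> B 1" "y \<in> B 1" "z \<in> B 1"
  shows "cm (cm x y) z \<otimes> cm (cm x y) z \<otimes> cm (cm x y) z = \<one>"
proof -
  have car: "x \<in> carrier G" "y \<in> carrier G" "z \<in> carrier G" using assms filt_carrier by blast+
  have B: "x \<in> B 4" "y \<in> B 4" "z \<in> B 4" "x \<in> B 8" "y \<in> B 8" "z \<in> B 8"
      "x \<in> B 16" "y \<in> B 16" "z \<in> B 16"
    using assms filt_le by simp_all
  define J where "J = cm (cm x y) z"
  have J: "J \<in> carrier G" unfolding J_def using car by simp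
  \<comment> \<open>Moving the inverse out gives [u,v^-1,w] = [u,v,w]^-1 = [u,w,v]. This commutes
    with \<open>v\<close> by \<open>engel\<close>, so the outer conjugation does nothing.\<close>
  have fixed: "conj_by G (cm (cm u (inv v)) w) v = inv (cm (cm u v) w)"
    if "u \<in> B 1" "v \<in> B 1" "w \<in> B 1" for u v w
  proof -
    have c: "u \<in> carrier G" "v \<in> carrier G" "w \<in> carrier G" using that filt_carrier by blast+
    have m: "u \<in> B 4" "v \<in> B 4" "w \<in> B 4" "v \<in> B 8" "u \<in> B 16" "v \<in> B 16" "w \<in> B 16"
      using that filt_le by simp_all
    have uw: "cm u w \<in> B 16" using filt_le [OF filt_commutator [OF that(1,3)]] by simp
    have uv: "cm u v \<in> B 16" using filt_le [OF filt_commutator [OF that(1,2)]] by simp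
    have "cm (cm u (inv v)) w = inv (cm (cm u v) w)"
      unfolding commutator_inv_right [OF m(5,4)]
      using c commute_conj [OF uv m(7)] by (intro commutator_inv_left) auto
    also have "\<dots> = cm (cm u w) v" using triple_commutator_swap_right_inv [OF m(1-3)] by simp
    finally have eq: "cm (cm u (inv v)) w = cm (cm u w) v" .
    have "conj_by G (cm (cm u w) v) v = cm (cm u w) v"
      using engel [OF uw m(6)] c by (simp add: conj_by_eq_self_iff)
    then show ?thesis
      unfolding eq using triple_commutator_swap_right_inv [OF m(1-3)] by simp
  qed
  have 1: "cm (cm x z) y = inv J"
    unfolding J_def by (rule triple_commutator_swap_right_inv [OF B(1-3)])
  have 2: "cm (cm y x) z = inv J"
    unfolding J_def by (rule triple_commutator_swap_left [OF B(1,2,9)])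
  have 3: "cm (cm y z) x = J"
    using triple_commutator_swap_right_inv [OF B(2,1,3)] 2 J by simp
  have 4: "cm (cm z x) y = J"
    using triple_commutator_swap_left [OF B(1,3,8)] 1 J by simp
  have "inv (cm (cm x y) z) \<otimes> inv (cm (cm y z) x) \<otimes> inv (cm (cm z x) y) = \<one>"
    using hall_witt [OF car] fixed [OF assms] fixed [OF assms(2,3,1)] fixed [OF assms(3,1,2)] by simp
  then have "inv J \<otimes> inv J \<otimes> inv J = \<one>" unfolding 3 4 J_def .
  then have "inv (J \<otimes> J \<otimes> J) = \<one>" using J by (simp add: inv_mult_group m_assoc)
  then show ?thesis unfolding J_def [symmetric] using J by simp
qed

text \<open>Commutation with \<open>g\<close> acts as g - 1 on an abelian group, hence additively.
  It raises the index by one, and commutativity is known up to index 8, so the arguments come from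
  index 7.\<close>

lemma conj_span_commutator_mult:
  assumes "x \<in> B 16" "p \<in> conj_span x 7" "q \<in> conj_span x 7" "g \<in> B 1"
  shows "cm (p \<otimes> q) g = cm p g \<otimes> cm q g"
proof -
  have x: "x \<in> carrier G" by (rule filt_carrier [OF assms(1)])
  have car: "p \<in> carrier G" "q \<in> carrier G" "g \<in> carrier G"
    using conj_span_carrier [OF x assms(2)] conj_span_carrier [OF x assms(3)]
      filt_carrier [OF assms(4)] .
  have "cm p g \<in> conj_span x 8" using conj_span_commutator [OF x assms(2,4)] by simp
  moreover have "q \<in> conj_span x 8" using conj_span_mono [of 7 8 x] assms(3) by auto
  ultimately have "cm p g \<otimes> q = q \<otimes> cm p g" by (rule conj_span_commute [OF assms(1) order_refl])
  then have "cm (cm p g) q = \<one>" using car by (simp add: commutator_eq_one_iff)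
  then show ?thesis using car by (simp add: commutator_mult_left)
qed

text \<open>
  The commutator \<open>[x, b, c, d]\<close> is alternating in \<open>b, c, d\<close>, and antisymmetry of \<open>[x, b, cd]\<close> gives
  \<open>[x, b, c, d] [x, c, d, b] = 1\<close>, so its square is trivial; its cube is trivial since
  \<open>[x, b, c]\<close> has trivial cube.
\<close>

lemma quadruple_commutator_eq_one:
  assumes "x \<in> B 1" "b \<in> B 1" "c \<in> B 1" "d \<in> B 1"
  shows "cm (cm (cm x b) c) d = \<one>"
proof -
  have car: "x \<in> carrier G" "b \<in> carrier G" "c \<in> carrier G" "d \<in> carrier G"
    using assms filt_carrier by blast+
  have B: "x \<in> B 4" "b \<in> B 4" "c \<in> B 4" "d \<in> B 4" "x \<in> B 16"
    using assms filt_le by simp_all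
  have cd: "c \<otimes> d \<in> B 4" using filt_le [OF filt_mult [OF assms(3,4)]] by simp
  have xs: "x \<in> conj_span x 0" by (rule conj_span_self [OF car(1)])
  have s1: "cm x g \<in> conj_span x 1" if "g \<in> B 1" for g
    using conj_span_commutator [OF car(1) xs that] by simp
  have s2: "cm (cm x g) h \<in> conj_span x 2" if "g \<in> B 1" "h \<in> B 1" for g h
    using conj_span_commutator [OF car(1) s1 [OF that(1)] that(2)] by (simp add: numeral_2_eq_2)
  have s3: "cm (cm (cm x g) h) i \<in> conj_span x 3" if "g \<in> B 1" "h \<in> B 1" "i \<in> B 1" for g h i
    using conj_span_commutator [OF car(1) s2 [OF that(1,2)] that(3)] by (simp add: eval_nat_numeral)
  have up: "p \<in> conj_span x 7" if "p \<in> conj_span x k" "k \<le> 7" for p k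
    using conj_span_mono [OF that(2)] that(1) by auto
  define f where "f g h i = cm (cm (cm x g) h) i" for g h i
  let ?S = "conj_span x 7"
  have "cm x (c \<otimes> d) = cm x d \<otimes> cm x c \<otimes> cm (cm x c) d"
    using car by (simp add: commutator_mult_right)
  moreover have "cm x d \<in> ?S" "cm x c \<in> ?S" "cm (cm x c) d \<in> ?S"
    using up [OF s1 [OF assms(4)]] up [OF s1 [OF assms(3)]] up [OF s2 [OF assms(3,4)]] by simp_all
  ultimately have 1: "cm (cm x (c \<otimes> d)) b = cm (cm x d) b \<otimes> cm (cm x c) b \<otimes> f c d b"
    unfolding f_def using conj_span_mult [OF car(1)]
    by (simp add: conj_span_commutator_mult [OF B(5) _ _ assms(2)])
  have 2: "cm (cm x b) (c \<otimes> d) = cm (cm x b) d \<otimes> cm (cm x b) c \<otimes> f b c d"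
    unfolding f_def using car by (simp add: commutator_mult_right)
  \<comment> \<open>In this expansion the terms of weight three cancel in pairs, by the swap
    relations for b, d and for b, c.\<close>
  have 3: "cm (cm x b) d \<otimes> cm (cm x b) c \<otimes> f b c d \<otimes>
      (cm (cm x d) b \<otimes> cm (cm x c) b \<otimes> f c d b) = \<one>"
    using triple_commutator_swap_right [OF B(1,2) cd] unfolding 1 2 .
  have S: "cm (cm x b) d \<in> ?S" "cm (cm x d) b \<in> ?S" "cm (cm x b) c \<in> ?S" "cm (cm x c) b \<in> ?S"
      "f b c d \<in> ?S" "f c d b \<in> ?S"
    unfolding f_def
    by (rule up [OF s2] up [OF s3]; (rule assms | simp))+
  have "comm_group (G\<lparr>carrier := ?S\<rparr>)" by (rule conj_span_comm_group [OF B(5)]) simp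
  from comm_group.six_factor_cancel [OF this, simplified, OF S]
  have ff: "f b c d \<otimes> f c d b = \<one>"
    using 3 triple_commutator_swap_right [OF B(1,2,4)] triple_commutator_swap_right [OF B(1,2,3)]
    by simp
  have xc: "cm x c \<in> B 4" using filt_le [OF filt_commutator [OF assms(1,3)]] by simp
  have fS: "f b c d \<in> carrier G" unfolding f_def using car by simp
  have J: "cm (cm x b) c \<in> conj_span x 2" by (rule s2 [OF assms(2,3)])
  \<comment> \<open>Two transpositions lead from [x,c,d,b] to [x,b,c,d]: first the last two entries
    over the base [x,c], then b and c.\<close>
  have "f c d b = inv (f c b d)"
    unfolding f_def by (rule triple_commutator_swap_right_inv [OF xc B(2,4)])
  also have "f c b d = inv (f b c d)"
    unfolding f_def triple_commutator_swap_right_inv [OF B(1-3)]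
  proof (rule commutator_inv_left)
    have "cj (cm (cm x b) c) d \<in> conj_span x 3"
      using conj_span_conj [OF car(1) J assms(4)] by (simp add: eval_nat_numeral)
    then show "cm (cm x b) c \<otimes> cj (cm (cm x b) c) d = cj (cm (cm x b) c) d \<otimes> cm (cm x b) c"
      using J conj_span_mono [of 2 3 x] by (intro conj_span_commute [OF B(5), of 3]) auto
  qed (use car in auto)
  finally have "f c d b = f b c d" using fS by simp
  then have square: "f b c d \<otimes> f b c d = \<one>" using ff by simp
  have J7: "cm (cm x b) c \<in> ?S" using up [OF J] by simp
  \<comment> \<open>Additivity sends the cube of [x,b,c], which is trivial, to the cube of
    [x,b,c,d]. Together with the trivial square this forces the commutator to be trivial.\<close>
  have "cm (cm (cm x b) c \<otimes> cm (cm x b) c \<otimes> cm (cm x b) c) d = f b c d \<otimes> f b c d \<otimes> f b c d"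
    unfolding f_def using J7 conj_span_mult [OF car(1)]
    by (simp add: conj_span_commutator_mult [OF B(5) _ _ assms(4)])
  then have "cm \<one> d = f b c d \<otimes> f b c d \<otimes> f b c d"
    using triple_commutator_cube [OF assms(1-3)] by simp
  then show ?thesis using square fS car(4) unfolding f_def [symmetric] by (simp add: commutator_def)
qed

end

section \<open>From commutator identities on generators to the group they generate\<close>

context group
begin

lemma generate_symmetric_induct [consumes 2, case_names one base mult]:
  assumes "h \<in> generate G U" "\<And>u. u \<in> U \<Longrightarrow> inv u \<in> U"
    and "P \<one>" "\<And>u. u \<in> U \<Longrightarrow> P u"
    and "\<And>g h. g \<in> generate G U \<Longrightarrow> h \<in> generate G U \<Longrightarrow> P g \<Longrightarrow> P h \<Longrightarrow> P (g \<otimes> h)"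
  shows "P h"
  using assms(1) by induction (use assms in auto)

text \<open>One argument at a time is extended from generators to the whole group. Nilpotency comes
  first, since it makes triple commutators multiplicative in each entry; antisymmetry and the Engel
  law then follow by expansion.\<close>

lemma two_engel_generate:
  assumes gen: "carrier G = generate G U"
    and sym: "\<And>u. u \<in> U \<Longrightarrow> inv u \<in> U"
    and engel: "\<And>x b. x \<in> U \<Longrightarrow> b \<in> U \<Longrightarrow> commutator G (commutator G x b) b = \<one>"
    and swap: "\<And>x b c. x \<in> U \<Longrightarrow> b \<in> U \<Longrightarrow> c \<in> U \<Longrightarrow>
      commutator G (commutator G x b) c \<otimes> commutator G (commutator G x c) b = \<one>"
    and nilp: "\<And>x b c d. x \<in> U \<Longrightarrow> b \<in> U \<Longrightarrow> c \<in> U \<Longrightarrow> d \<in> U \<Longrightarrow>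
      commutator G (commutator G (commutator G x b) c) d = \<one>"
    and "g \<in> carrier G" "h \<in> carrier G"
  shows "commutator G (commutator G g h) h = \<one>"
proof -
  let ?c = "commutator G"
  have U: "u \<in> carrier G" if "u \<in> U" for u unfolding gen using that by (rule generate.incl)
  have induct [consumes 1, case_names one base mult]: "P k"
    if "k \<in> carrier G" "P \<one>" "\<And>u. u \<in> U \<Longrightarrow> P u"
      "\<And>k l. k \<in> carrier G \<Longrightarrow> l \<in> carrier G \<Longrightarrow> P k \<Longrightarrow> P l \<Longrightarrow> P (k \<otimes> l)" for P k
    using that(1) unfolding gen
    by (rule generate_symmetric_induct) (use sym that(2-4) gen in auto)
  have one_left: "?c \<one> k = \<one>" and one_right: "?c k \<one> = \<one>" if "k \<in> carrier G" for k
    using that by (simp_all add: commutator_eq_one_iff)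
  \<comment> \<open>The centre and the second centre.\<close>
  define Z where "Z = {z \<in> carrier G. \<forall>k\<in>carrier G. z \<otimes> k = k \<otimes> z}"
  define Z2 where "Z2 = {u \<in> carrier G. \<forall>k\<in>carrier G. ?c u k \<in> Z}"
  have Zc: "z \<in> carrier G" "?c z k = \<one>" "z \<otimes> k = k \<otimes> z" if "z \<in> Z" "k \<in> carrier G" for z k
    using that unfolding Z_def by (auto simp: commutator_eq_one_iff)
  have Zone: "\<one> \<in> Z" unfolding Z_def by auto
  have Zmult: "y \<otimes> z \<in> Z" if "y \<in> Z" "z \<in> Z" for y z
  proof -
    have c: "y \<in> carrier G" "z \<in> carrier G" using that unfolding Z_def by auto
    have "y \<otimes> z \<otimes> k = k \<otimes> (y \<otimes> z)" if k: "k \<in> carrier G" for k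
      using c k Zc(3) [OF \<open>y \<in> Z\<close> k] Zc(3) [OF \<open>z \<in> Z\<close> k] by (metis m_assoc)
    then show ?thesis unfolding Z_def using c by auto
  qed
  have Z2c: "u \<in> carrier G" if "u \<in> Z2" for u using that unfolding Z2_def by auto
  have Z2: "?c u k \<in> Z" if "u \<in> Z2" "k \<in> carrier G" for u k using that unfolding Z2_def by auto
  have ZZ2: "z \<in> Z2" if "z \<in> Z" for z
  proof -
    have "z \<in> carrier G" using that unfolding Z_def by simp
    then show ?thesis using Zone Zc(2) [OF that] unfolding Z2_def by simp
  qed
  have right: "?c u (k \<otimes> l) = ?c u k \<otimes> ?c u l"
    if "u \<in> Z2" "k \<in> carrier G" "l \<in> carrier G" for u k l
  proof -
    note u = Z2c [OF that(1)]
    have "?c u (k \<otimes> l) = ?c u l \<otimes> ?c u k"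
      using that u Zc(2) [OF Z2 [OF that(1,2)] that(3)] by (simp add: commutator_mult_right)
    also have "\<dots> = ?c u k \<otimes> ?c u l"
      using that u by (intro Zc(3) Z2) auto
    finally show ?thesis .
  qed
  have left: "?c (u \<otimes> v) k = ?c u k \<otimes> ?c v k"
    if "u \<in> Z2" "v \<in> Z2" "k \<in> carrier G" for u v k
    using that Z2c [OF that(1)] Z2c [OF that(2)] Zc(2) [OF Z2 [OF that(1,3)], of v]
    by (simp add: commutator_mult_left)
  have Z2mult: "u \<otimes> v \<in> Z2" if "u \<in> Z2" "v \<in> Z2" for u v
  proof -
    have "?c (u \<otimes> v) k \<in> Z" if k: "k \<in> carrier G" for k
      unfolding left [OF \<open>u \<in> Z2\<close> \<open>v \<in> Z2\<close> k] by (rule Zmult [OF Z2 Z2]) (rule that \<open>u \<in> Z2\<close> \<open>v \<in> Z2\<close>)+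
    moreover have "u \<otimes> v \<in> carrier G" using that by (intro m_closed Z2c)
    ultimately show ?thesis unfolding Z2_def by simp
  qed
  have 1: "?c (?c x b) c \<in> Z" if "x \<in> U" "b \<in> U" "c \<in> U" for x b c
  proof -
    have J: "?c (?c x b) c \<in> carrier G" using that U by auto
    have "?c (?c x b) c \<otimes> k = k \<otimes> ?c (?c x b) c" if "k \<in> carrier G" for k
      using that
    proof (induction rule: induct)
      case one then show ?case using J by simp
    next
      case (base u)
      then show ?case using nilp [OF \<open>x \<in> U\<close> \<open>b \<in> U\<close> \<open>c \<in> U\<close> base] J U by (simp add: commutator_eq_one_iff)
    next
      case (mult k l)
      then show ?case using J by (metis m_assoc)
    qed
    then show ?thesis unfolding Z_def using J by auto
  qed
  \<comment> \<open>When \<open>k\<close> is a product, the correction term is a commutator with a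
    central element and vanishes.\<close>
  have 2: "?c x b \<in> Z2" if "x \<in> U" "b \<in> U" for x b
  proof -
    have u: "?c x b \<in> carrier G" using that U by auto
    have "?c (?c x b) k \<in> Z" if "k \<in> carrier G" for k
      using that
    proof (induction rule: induct)
      case one then show ?case using u Zone one_right by simp
    next
      case (base c) then show ?case using 1 that \<open>x \<in> U\<close> \<open>b \<in> U\<close> by blast
    next
      case (mult k l)
      have "?c (?c x b) (k \<otimes> l) = ?c (?c x b) l \<otimes> ?c (?c x b) k"
        using u mult Zc(2) [OF mult.IH(1) mult.hyps(2)] by (simp add: commutator_mult_right)
      then show ?case using Zmult [OF mult.IH(2,1)] by simp
    qed
    then show ?thesis unfolding Z2_def using u by auto
  qed
  \<comment> \<open>The correction term [x,k,l] is now central, because \<open>?c x k\<close> lies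
    in the second centre by induction.\<close>
  have 3: "?c x k \<in> Z2" if "x \<in> U" "k \<in> carrier G" for x k
    using that(2)
  proof (induction rule: induct)
    case one then show ?case using U that ZZ2 Zone one_right by simp
  next
    case (base u) then show ?case using 2 that by blast
  next
    case (mult k l)
    have "?c x (k \<otimes> l) = ?c x l \<otimes> ?c x k \<otimes> ?c (?c x k) l"
      using mult U [OF that(1)] by (intro commutator_mult_right)
    also have "\<dots> \<in> Z2" by (intro Z2mult ZZ2 Z2 mult)
    finally show ?case .
  qed
  \<comment> \<open>All commutators lie in the second centre, so the class is at most 3.\<close>
  have derived: "?c g k \<in> Z2" if "g \<in> carrier G" "k \<in> carrier G" for g k
    using that(1)
  proof (induction rule: induct)
    case one then show ?case using that ZZ2 Zone one_left by simp
  next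
    case (base u) then show ?case using 3 that by blast
  next
    case (mult g l)
    have "?c (g \<otimes> l) k = ?c g k \<otimes> ?c (?c g k) l \<otimes> ?c l k"
      using mult that by (intro commutator_mult_left)
    also have "\<dots> \<in> Z2" by (intro Z2mult ZZ2 Z2 mult)
    finally show ?case .
  qed
  \<comment> \<open>The correction term of the inner commutator is central and disappears in the
    outer one.\<close>
  have lin1: "?c (?c (g \<otimes> g') k) l = ?c (?c g k) l \<otimes> ?c (?c g' k) l"
    if "g \<in> carrier G" "g' \<in> carrier G" "k \<in> carrier G" "l \<in> carrier G" for g g' k l
  proof -
    have z: "?c (?c g k) g' \<in> Z" by (intro Z2 derived that)
    have "?c (?c (g \<otimes> g') k) l = ?c (?c g k \<otimes> ?c (?c g k) g' \<otimes> ?c g' k) l"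
      unfolding commutator_mult_left [OF that(1-3)] ..
    also have "\<dots> = ?c (?c g k) l \<otimes> ?c (?c (?c g k) g') l \<otimes> ?c (?c g' k) l"
      using left [OF Z2mult [OF derived ZZ2 [OF z]] derived, OF that(1,3,2,3,4)]
        left [OF derived ZZ2 [OF z], OF that(1,3,4)] by simp
    finally show ?thesis using Zc(2) [OF z that(4)] that by simp
  qed
  have lin2: "?c (?c g (k \<otimes> k')) l = ?c (?c g k') l \<otimes> ?c (?c g k) l"
    if "g \<in> carrier G" "k \<in> carrier G" "k' \<in> carrier G" "l \<in> carrier G" for g k k' l
  proof -
    have z: "?c (?c g k) k' \<in> Z" by (intro Z2 derived that)
    have "?c (?c g (k \<otimes> k')) l = ?c (?c g k' \<otimes> ?c g k \<otimes> ?c (?c g k) k') l"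
      unfolding commutator_mult_right [OF that(1-3)] ..
    also have "\<dots> = ?c (?c g k') l \<otimes> ?c (?c g k) l \<otimes> ?c (?c (?c g k) k') l"
      using left [OF Z2mult [OF derived derived] ZZ2 [OF z], OF that(1,3,1,2,4)]
        left [OF derived derived, OF that(1,3,1,2,4)] by simp
    finally show ?thesis using Zc(2) [OF z that(4)] that by simp
  qed
  have lin3: "?c (?c g k) (l \<otimes> l') = ?c (?c g k) l \<otimes> ?c (?c g k) l'"
    if "g \<in> carrier G" "k \<in> carrier G" "l \<in> carrier G" "l' \<in> carrier G" for g k l l'
    by (rule right [OF derived]) (rule that)+
  \<comment> \<open>The factors in \<open>lin2\<close> come in the reverse order of those in
    \<open>lin3\<close>, so mutually inverse terms are nested.\<close>
  have cancel: "p \<otimes> q \<otimes> (q' \<otimes> p') = \<one>"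
    if "q \<otimes> q' = \<one>" "p \<otimes> p' = \<one>" "p \<in> carrier G" "q \<in> carrier G" "p' \<in> carrier G" "q' \<in> carrier G"
    for p q p' q'
    using that by (metis m_assoc m_closed r_one)
  have swap1: "?c (?c x k) c \<otimes> ?c (?c x c) k = \<one>"
    if "x \<in> U" "k \<in> carrier G" "c \<in> U" for x k c
    using that(2)
  proof (induction rule: induct)
    case one then show ?case using U that one_left one_right by simp
  next
    case (base u) then show ?case using swap that by blast
  next
    case (mult k k')
    then show ?case using U [OF that(1)] U [OF that(3)] by (simp add: lin2 lin3 cancel)
  qed
  have swap2: "?c (?c x k) l \<otimes> ?c (?c x l) k = \<one>"
    if "x \<in> U" "k \<in> carrier G" "l \<in> carrier G" for x k l
    using that(3)
  proof (induction rule: induct)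
    case one then show ?case using U that one_left one_right by simp
  next
    case (base u) then show ?case using swap1 that by blast
  next
    case (mult l l')
    show ?case using mult U [OF that(1)] that(2) by (simp add: lin2 lin3 cancel)
  qed
  \<comment> \<open>A product in both places gives four terms: the two pure ones are trivial by
    induction, and the two mixed ones cancel by \<open>swap2\<close>.\<close>
  have sq: "?c (?c x k) k = \<one>" if "x \<in> U" "k \<in> carrier G" for x k
    using that(2)
  proof (induction rule: induct)
    case one then show ?case using U that one_left one_right by simp
  next
    case (base u) then show ?case using engel that by blast
  next
    case (mult l l')
    then show ?case using U [OF that(1)] swap2 [OF that(1), of l' l] by (simp add: lin2 lin3)
  qed
  show ?thesis
    using assms(6)
  proof (induction rule: induct)
    case one then show ?case using assms(7) one_left by simp
  next
    case (base u) then show ?case using sq assms(7) by blast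
  next
    case (mult l l')
    then show ?case using assms(7) by (simp add: lin1)
  qed
qed

section \<open>Automorphisms of order three and twisted cubes\<close>

text \<open>
  If \<open>\<theta>\<close> is conjugation by an element \<open>t\<close> with \<open>t\<^sup>3 = 1\<close>, this says \<open>(t w)\<^sup>3 = 1\<close>. The two twists below
  replace \<open>t\<close> by \<open>t c\<close> and by \<open>c t\<close>.
\<close>

definition splits_at :: "('a \<Rightarrow> 'a) \<Rightarrow> 'a \<Rightarrow> bool" where
  "splits_at \<theta> w \<longleftrightarrow> \<theta> (\<theta> w) \<otimes> \<theta> w \<otimes> w = \<one>"

text \<open>With p and q the first and second images of \<open>a\<close>, the equation at
  \<open>a\<close> gives qpa = 1, its image under \<theta> gives aqp = 1, and the equation at
  \<open>inv a\<close> gives apq = 1. So p and q commute, and \<theta> applied twice carries them to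
  \<open>a\<close> and p.\<close>

lemma splits_at_commute:
  assumes "\<theta> \<in> hom G G" "\<forall>g\<in>carrier G. \<theta> (\<theta> (\<theta> g)) = g"
    and "a \<in> carrier G" "splits_at \<theta> a" "splits_at \<theta> (inv a)"
  shows "a \<otimes> \<theta> a = \<theta> a \<otimes> a"
proof -
  interpret \<theta>: group_hom G G \<theta> using assms(1) by unfold_locales
  define p where "p = \<theta> a"
  define q where "q = \<theta> p"
  have c: "a \<in> carrier G" "p \<in> carrier G" "q \<in> carrier G" unfolding p_def q_def using assms(3) by auto
  have \<theta>q: "\<theta> q = a" unfolding q_def p_def using assms(2,3) by simp
  have 1: "q \<otimes> p \<otimes> a = \<one>" using assms(4) unfolding splits_at_def p_def q_def .
  have "inv q \<otimes> inv p \<otimes> inv a = \<one>"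
    using assms(5) c unfolding splits_at_def p_def q_def by simp
  then have "inv (a \<otimes> p \<otimes> q) = \<one>" using c by (simp add: inv_mult_group m_assoc)
  then have 2: "a \<otimes> p \<otimes> q = \<one>" using c by simp
  have "\<theta> (q \<otimes> p \<otimes> a) = \<one>" using 1 by simp
  then have "a \<otimes> q \<otimes> p = \<one>" using c \<theta>q by (simp add: p_def [symmetric] q_def [symmetric])
  with 2 have "a \<otimes> (p \<otimes> q) = a \<otimes> (q \<otimes> p)" using c by (simp add: m_assoc)
  then have "p \<otimes> q = q \<otimes> p" using c by simp
  then have "\<theta> (\<theta> (p \<otimes> q)) = \<theta> (\<theta> (q \<otimes> p))" by simp
  then show ?thesis using c \<theta>q by (simp add: p_def [symmetric] q_def [symmetric])
qed

lemma twist_right: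
  assumes "\<theta> \<in> hom G G" "\<forall>g\<in>carrier G. \<theta> (\<theta> (\<theta> g)) = g"
    and c: "c \<in> carrier G" "splits_at \<theta> c"
  defines "\<phi> \<equiv> \<lambda>g. conj_by G (\<theta> g) c"
  shows "\<phi> \<in> hom G G" "\<forall>g\<in>carrier G. \<phi> (\<phi> (\<phi> g)) = g"
    "\<And>w. w \<in> carrier G \<Longrightarrow> splits_at \<theta> (c \<otimes> w) \<Longrightarrow> splits_at \<phi> w"
proof -
  interpret \<theta>: group_hom G G \<theta> using assms(1) by unfold_locales
  have s: "\<theta> (\<theta> c) \<otimes> \<theta> c \<otimes> c = \<one>" using c unfolding splits_at_def by simp
  show "\<phi> \<in> hom G G" unfolding \<phi>_def using c by (intro homI) (auto simp: conj_by_mult)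
  show "\<forall>g\<in>carrier G. \<phi> (\<phi> (\<phi> g)) = g"
  proof
    fix g assume that: "g \<in> carrier G"
    \<comment> \<open>The third iterate is conjugation by the product that stands for (tc)^3, which
      is trivial.\<close>
    have "\<phi> (\<phi> (\<phi> g)) = inv (\<theta> (\<theta> c) \<otimes> \<theta> c \<otimes> c) \<otimes> g \<otimes> (\<theta> (\<theta> c) \<otimes> \<theta> c \<otimes> c)"
      unfolding \<phi>_def conj_by_def using that c assms(2) by (simp add: word_simps)
    then show "\<phi> (\<phi> (\<phi> g)) = g" unfolding s using that by simp
  qed
  show "splits_at \<phi> w" if w: "w \<in> carrier G" "splits_at \<theta> (c \<otimes> w)" for w
  proof -
    have "\<phi> (\<phi> w) \<otimes> \<phi> w \<otimes> w = inv (\<theta> (\<theta> c) \<otimes> \<theta> c \<otimes> c) \<otimes> (\<theta> (\<theta> (c \<otimes> w)) \<otimes> \<theta> (c \<otimes> w) \<otimes> (c \<otimes> w))"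
      unfolding \<phi>_def conj_by_def using w(1) c by (simp add: word_simps)
    then show ?thesis unfolding s using w(2) by (simp add: splits_at_def)
  qed
qed

lemma twist_left:
  assumes "\<theta> \<in> hom G G" "\<forall>g\<in>carrier G. \<theta> (\<theta> (\<theta> g)) = g"
    and c: "c \<in> carrier G" "splits_at \<theta> c"
  defines "\<phi> \<equiv> \<lambda>g. \<theta> (conj_by G g c)"
  shows "\<phi> \<in> hom G G" "\<forall>g\<in>carrier G. \<phi> (\<phi> (\<phi> g)) = g"
    "\<And>w. w \<in> carrier G \<Longrightarrow> splits_at \<theta> (w \<otimes> c) \<Longrightarrow> splits_at \<phi> w"
proof -
  interpret \<theta>: group_hom G G \<theta> using assms(1) by unfold_locales
  \<comment> \<open>Applying \<theta> rotates the three factors cyclically and so turns (tc)^3 into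
    (ct)^3.\<close>
  have "\<theta> (\<theta> (\<theta> c) \<otimes> \<theta> c \<otimes> c) = \<one>" using c unfolding splits_at_def by simp
  then have s: "c \<otimes> \<theta> (\<theta> c) \<otimes> \<theta> c = \<one>" using c assms(2) by simp
  show "\<phi> \<in> hom G G" unfolding \<phi>_def using c by (intro homI) (auto simp: conj_by_mult)
  show "\<forall>g\<in>carrier G. \<phi> (\<phi> (\<phi> g)) = g"
  proof
    fix g assume that: "g \<in> carrier G"
    have "\<phi> (\<phi> (\<phi> g)) = inv (c \<otimes> \<theta> (\<theta> c) \<otimes> \<theta> c) \<otimes> g \<otimes> (c \<otimes> \<theta> (\<theta> c) \<otimes> \<theta> c)"
      unfolding \<phi>_def conj_by_def using that c assms(2) by (simp add: word_simps)
    then show "\<phi> (\<phi> (\<phi> g)) = g" unfolding s using that by simp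
  qed
  show "splits_at \<phi> w" if w: "w \<in> carrier G" "splits_at \<theta> (w \<otimes> c)" for w
  proof -
    \<comment> \<open>This reflects (ctw)^3 = c (twc)^3 c^-1.\<close>
    have "\<phi> (\<phi> w) \<otimes> \<phi> w \<otimes> w =
        inv (c \<otimes> \<theta> (\<theta> c) \<otimes> \<theta> c) \<otimes> (c \<otimes> (\<theta> (\<theta> (w \<otimes> c)) \<otimes> \<theta> (w \<otimes> c) \<otimes> (w \<otimes> c)) \<otimes> inv c)"
      unfolding \<phi>_def conj_by_def using w(1) c by (simp add: word_simps)
    then show ?thesis unfolding s using w(2) c(1) by (simp add: splits_at_def)
  qed
qed

lemma splits_at_commute_conj:
  assumes \<theta>: "\<theta> \<in> hom G G" "\<forall>g\<in>carrier G. \<theta> (\<theta> (\<theta> g)) = g"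
    and ab: "a \<in> carrier G" "b \<in> carrier G"
    and s: "splits_at \<theta> a" "splits_at \<theta> b" "splits_at \<theta> (inv b)" "splits_at \<theta> (a \<otimes> b)"
      "splits_at \<theta> (inv a \<otimes> b)" "splits_at \<theta> (inv b \<otimes> a)" "splits_at \<theta> (inv b \<otimes> inv a)"
  shows "a \<otimes> conj_by G a b = conj_by G a b \<otimes> a"
proof -
  interpret \<theta>: group_hom G G \<theta> using \<theta>(1) by unfold_locales
  let ?d = "conj_by G a b"
  have ib: "inv b \<in> carrier G" "inv a \<in> carrier G" using ab by auto
  \<comment> \<open>For t b^-1 in place of t, the equations at \<open>a\<close> and
    \<open>inv a\<close> come from the words b^-1 a and b^-1 a^-1. Conjugating the result by
    \<open>b\<close> then cancels b^-1.\<close>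
  note R = twist_right [OF \<theta> ib(1) s(3)]
  have "a \<otimes> conj_by G (\<theta> a) (inv b) = conj_by G (\<theta> a) (inv b) \<otimes> a"
    by (rule splits_at_commute [OF R(1,2) ab(1) R(3) [OF ab(1) s(6)] R(3) [OF ib(2) s(7)]])
  then have "?d \<otimes> conj_by G (conj_by G (\<theta> a) (inv b)) b = conj_by G (conj_by G (\<theta> a) (inv b)) b \<otimes> ?d"
    using ab by (intro commute_conj_by) auto
  then have 1: "?d \<otimes> \<theta> a = \<theta> a \<otimes> ?d" using ab by (simp add: conj_by_conj_by)
  \<comment> \<open>For b t in place of t, the words are ab and a^-1 b. Applying \<theta> twice
    afterwards frees \<open>?d\<close> from \<theta>.\<close>
  note L = twist_left [OF \<theta> ab(2) s(2)]
  have "a \<otimes> \<theta> ?d = \<theta> ?d \<otimes> a"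
    by (rule splits_at_commute [OF L(1,2) ab(1) L(3) [OF ab(1) s(4)] L(3) [OF ib(2) s(5)]])
  then have "\<theta> (\<theta> (a \<otimes> \<theta> ?d)) = \<theta> (\<theta> (\<theta> ?d \<otimes> a))" by simp
  then have 2: "?d \<otimes> \<theta> (\<theta> a) = \<theta> (\<theta> a) \<otimes> ?d" using ab \<theta>(2) by simp
  have "?d \<otimes> (\<theta> (\<theta> a) \<otimes> \<theta> a) = (\<theta> (\<theta> a) \<otimes> \<theta> a) \<otimes> ?d"
    using 1 2 ab by (metis \<theta>.hom_closed conj_by_closed m_assoc)
  then have "?d \<otimes> inv (\<theta> (\<theta> a) \<otimes> \<theta> a) = inv (\<theta> (\<theta> a) \<otimes> \<theta> a) \<otimes> ?d"
    using ab by (intro commute_inv) auto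
  moreover have "inv (\<theta> (\<theta> a) \<otimes> \<theta> a) = a"
    using s(1) ab unfolding splits_at_def by (metis \<theta>.hom_closed inv_equality inv_inv m_closed)
  ultimately show ?thesis by simp
qed

end

section \<open>Common points of translates of a set of positive Haar measure\<close>

text \<open>The complement is the image of a closed set under the projection along the compact factor.\<close>

lemma openin_tube:
  assumes "compact_space Y" "continuous_map (prod_topology X Y) Z f" "openin Z W"
  shows "openin X {x \<in> topspace X. \<forall>y\<in>topspace Y. f (x, y) \<in> W}"
proof -
  let ?C = "{p \<in> topspace (prod_topology X Y). f p \<in> topspace Z - W}"
  have "closedin Z (topspace Z - W)" using assms(3) by blast
  then have "closedin (prod_topology X Y) ?C"
    using assms(2) closedin_continuous_map_preimage by blast
  then have "closedin X (fst ` ?C)"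
    using closed_map_fst [OF assms(1)] unfolding closed_map_def by blast
  moreover have "topspace X - fst ` ?C = {x \<in> topspace X. \<forall>y\<in>topspace Y. f (x, y) \<in> W}"
    using continuous_map_image_subset_topspace [OF assms(2)] by (force simp: image_subset_iff)
  ultimately show ?thesis by (metis (no_types, lifting) closedin_def)
qed

context topological_group
begin

lemma continuous_map_mult:
  assumes "continuous_map X T f" "continuous_map X T g"
  shows "continuous_map X T (\<lambda>x. f x \<otimes> g x)"
  using continuous_map_compose [OF _ continuous_mult, of X "\<lambda>x. (f x, g x)"] assms
  by (simp add: continuous_map_pairwise o_def)

lemma continuous_map_inv:
  assumes "continuous_map X T f"
  shows "continuous_map X T (\<lambda>x. inv f x)"
  using continuous_map_compose [OF assms continuous_inv] by (simp add: o_def)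

lemma continuous_map_left_mult: "g \<in> carrier G \<Longrightarrow> continuous_map T T (\<lambda>x. g \<otimes> x)"
  by (rule continuous_map_mult) (auto simp: topspace_eq_carrier)

lemma l_coset_eq_image: "g <# K = (\<lambda>k. g \<otimes> k) ` K"
  unfolding l_coset_def by auto

text \<open>Take a compact \<open>K\<close> inside \<open>S\<close> and an open \<open>W\<close>
  around it of only slightly larger measure. For w near the identity the translate
  \<open>w <# K\<close> stays in \<open>W\<close> and misses little of it, so \<open>n\<close> such
  translates have a common point.\<close>

lemma haar_positive_translates:
  assumes "compact_space T" "Hausdorff_space T" "normalized_haar_measure G T M"
    and S: "S \<in> sets (completion M)" "emeasure (completion M) S > 0"
  shows "\<exists>V. openin T V \<and> \<one> \<in> V \<and>
    (\<forall>W. finite W \<longrightarrow> card W \<le> n \<longrightarrow> W \<subseteq> V \<longrightarrow> (\<exists>x\<in>carrier G. \<forall>w\<in>W. inv w \<otimes> x \<in> S))"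
proof -
  have sets: "sets M = sets (borel_of T)"
    and one: "emeasure M (space M) = 1"
    and inv: "\<And>g A. g \<in> carrier G \<Longrightarrow> A \<in> sets M \<Longrightarrow> emeasure M (g <# A) = emeasure M A"
    and outer: "\<And>A. A \<in> sets M \<Longrightarrow>
      emeasure M A = (INF U\<in>{U. openin T U \<and> A \<subseteq> U}. emeasure M U)"
    using assms(3) unfolding normalized_haar_measure_def by blast+
  have space: "space M = carrier G"
    using sets_eq_imp_space_eq [OF sets] by (simp add: borel_of_def space_measure_of_conv topspace_eq_carrier)
  interpret M: finite_measure M using one by (intro finite_measureI) simp
  have opn: "U \<in> sets M" if "openin T U" for U
  proof -
    have "{U. openin T U} \<subseteq> Pow (topspace T)" using openin_subset by auto
    then show ?thesis unfolding sets borel_of_def using that by (auto simp: sets_measure_of)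
  qed
  have cls: "C \<in> sets M" if "closedin T C" for C
  proof -
    have "space M - (topspace T - C) \<in> sets M" using that opn by (intro sets.compl_sets) auto
    moreover have "space M - (topspace T - C) = C"
      using closedin_subset [OF that] by (auto simp: space topspace_eq_carrier)
    ultimately show ?thesis by simp
  qed
  have approx: "\<exists>U. openin T U \<and> A \<subseteq> U \<and> measure M U < measure M A + e"
    if "A \<in> sets M" "e > 0" for A and e :: real
  proof -
    have "emeasure M A < ennreal (measure M A + e)"
      unfolding M.emeasure_eq_measure using that by (intro ennreal_lessI) (auto simp: add_nonneg_pos)
    then have "\<exists>U\<in>{U. openin T U \<and> A \<subseteq> U}. emeasure M U < ennreal (measure M A + e)"
      unfolding outer [OF that(1)] INF_less_iff .
    then show ?thesis using that by (auto simp: M.emeasure_eq_measure ennreal_less_iff simp del: ennreal_plus)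
  qed
  \<comment> \<open>A measurable set of the completion contains a Borel set of the same
    measure.\<close>
  define A where "A = main_part M S"
  have A: "A \<in> sets M" "A \<subseteq> S" "A \<subseteq> space M"
    unfolding A_def
    using main_part_sets [OF S(1)] main_part_null_part_Un [OF S(1)]
      sets.sets_into_space [OF main_part_sets [OF S(1)]]
    by blast+
  have "emeasure M A > 0" unfolding A_def using S by simp
  then have mA: "measure M A > 0" by (simp add: M.emeasure_eq_measure)
  \<comment> \<open>Outer regularity of the complement yields a closed subset of \<open>A\<close> of
    positive measure.\<close>
  obtain U where U: "openin T U" "space M - A \<subseteq> U" "measure M U < measure M (space M - A) + measure M A"
    using approx [of "space M - A" "measure M A"] A mA by auto
  define K where "K = topspace T - U"
  have "closedin T K" unfolding K_def using U(1) by blast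
  moreover have "K \<subseteq> A" "K \<subseteq> carrier G"
    unfolding K_def using U(2) by (auto simp: space topspace_eq_carrier)
  ultimately have K: "closedin T K" "K \<subseteq> A" "K \<subseteq> carrier G" by blast+
  have "measure M K = measure M (space M) - measure M U"
    unfolding K_def topspace_eq_carrier space [symmetric] by (rule M.finite_measure_compl [OF opn [OF U(1)]])
  then have mK: "measure M K > 0" using U(3) M.finite_measure_compl [OF A(1)] by simp
  have compact: "compactin T K" using closedin_compact_space [OF assms(1) K(1)] .
  \<comment> \<open>The denominator \<open>Suc n\<close> keeps n times \<open>e\<close> strictly
    below the measure of \<open>K\<close>, also for n = 0.\<close>
  define e where "e = measure M K / Suc n"
  have e: "e > 0" unfolding e_def using mK by simp
  obtain W where W: "openin T W" "K \<subseteq> W" "measure M W < measure M K + e"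
    using approx [OF cls [OF K(1)] e] by auto
  \<comment> \<open>The elements that translate \<open>K\<close> into \<open>W\<close>, phrased for
    \<open>openin_tube\<close> with \<open>K\<close> as the compact factor.\<close>
  define V where "V = {g \<in> topspace T. \<forall>k\<in>topspace (subtopology T K). (\<lambda>(x, y). x \<otimes> y) (g, k) \<in> W}"
  have topK: "topspace (subtopology T K) = K" using K(3) by (auto simp: topspace_eq_carrier)
  have "openin T V" unfolding V_def
  proof (rule openin_tube)
    show "compact_space (subtopology T K)" using compact compact_space_subtopology by blast
    show "continuous_map (prod_topology T (subtopology T K)) T (\<lambda>(x, y). x \<otimes> y)"
      using continuous_map_from_subtopology [OF continuous_mult, of "topspace T \<times> K"]
      by (simp add: subtopology_Times)
  qed (rule W(1))
  moreover have "\<one> \<in> V" unfolding V_def using W(2) K(3) by (auto simp: topspace_eq_carrier)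
  moreover have "\<exists>x\<in>carrier G. \<forall>w\<in>F. inv w \<otimes> x \<in> S" if F: "finite F" "card F \<le> n" "F \<subseteq> V" for F
  proof -
    have FG: "w \<in> carrier G" if "w \<in> F" for w using that F unfolding V_def by (auto simp: topspace_eq_carrier)
    have wK: "w <# K \<in> sets M" if "w \<in> F" for w
      unfolding l_coset_eq_image
      by (intro cls compactin_imp_closedin assms(2) image_compactin [OF compact] continuous_map_left_mult FG that)
    have wKW: "w <# K \<subseteq> W" if "w \<in> F" for w
      using that F(3) K(3) unfolding V_def topK l_coset_eq_image by auto
    have mwK: "measure M (w <# K) = measure M K" if "w \<in> F" for w
      unfolding measure_def using inv [OF FG [OF that] cls [OF K(1)]] by simp
    have diff: "measure M (W - (w <# K)) \<le> e" if "w \<in> F" for w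
      using M.finite_measure_Diff [OF opn [OF W(1)] wK wKW, OF that that] mwK [OF that] W(3) by simp
    have "measure M (\<Union>w\<in>F. W - (w <# K)) \<le> (\<Sum>w\<in>F. measure M (W - (w <# K)))"
      using F(1) wK opn [OF W(1)] by (intro M.finite_measure_subadditive_finite) auto
    also have "\<dots> \<le> (\<Sum>w\<in>F. e)" by (rule sum_mono [OF diff])
    also have "\<dots> \<le> n * e" using F(2) e by simp
    also have "\<dots> < measure M K"
      using e unfolding e_def by (simp add: field_simps mK)
    also have "\<dots> \<le> measure M W" by (rule M.finite_measure_mono [OF W(2) opn [OF W(1)]])
    \<comment> \<open>The parts of \<open>W\<close> missed by the translates do not cover
      \<open>W\<close>; a point outside all of them lies in every translate.\<close>
    finally have "\<not> W \<subseteq> (\<Union>w\<in>F. W - (w <# K))"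
      using M.finite_measure_mono [of W "\<Union>w\<in>F. W - (w <# K)"] F(1) wK opn [OF W(1)] by fastforce
    then obtain x where x: "x \<in> W" "\<And>w. w \<in> F \<Longrightarrow> x \<in> w <# K" by auto
    have xG: "x \<in> carrier G" using openin_subset [OF W(1)] x(1) by (auto simp: topspace_eq_carrier)
    have "inv w \<otimes> x \<in> S" if w: "w \<in> F" for w
    proof -
      obtain k where k: "k \<in> K" "x = w \<otimes> k" using x(2) [OF w] unfolding l_coset_eq_image by auto
      then have "inv w \<otimes> x = k" using FG [OF w] K(3) inv_mult_cancel_left [of w k] by auto
      then show ?thesis using k K(2) A(2) by auto
    qed
    then show ?thesis using xG by blast
  qed
  ultimately show ?thesis by blast
qed

end

section \<open>Words of bounded length in a set\<close>

text \<open>Words of length exactly n; once the identity lies in \<open>U\<close>, shorter words can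
  be padded, which is \<open>word_ball_mono\<close>.\<close>

primrec word_ball :: "('a, 'b) monoid_scheme \<Rightarrow> 'a set \<Rightarrow> nat \<Rightarrow> 'a set" where
  "word_ball G U 0 = {\<one>\<^bsub>G\<^esub>}"
| "word_ball G U (Suc n) = U <#>\<^bsub>G\<^esub> word_ball G U n"

context group
begin

lemma word_ball_mono_set: "U \<subseteq> V \<Longrightarrow> word_ball G U n \<subseteq> word_ball G V n"
  by (induction n) (auto simp: set_mult_def)

context
  fixes U :: "'a set"
  assumes U: "U \<subseteq> carrier G"
begin

lemma word_ball_closed: "word_ball G U n \<subseteq> carrier G"
  by (induction n) (use U in \<open>auto simp: set_mult_def\<close>)

lemma word_ball_one: "word_ball G U 1 = U"
  using U by (force simp: set_mult_def)

lemma word_ball_mult: "x \<in> word_ball G U m \<Longrightarrow> y \<in> word_ball G U n \<Longrightarrow> x \<otimes> y \<in> word_ball G U (m + n)"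
proof (induction m arbitrary: x)
  case 0
  then show ?case using subsetD [OF word_ball_closed] by auto
next
  case (Suc m)
  then obtain u z where x: "u \<in> U" "z \<in> word_ball G U m" "x = u \<otimes> z" by (auto simp: set_mult_def)
  then have "x \<otimes> y = u \<otimes> (z \<otimes> y)" using U word_ball_closed Suc.prems by (auto simp: m_assoc subset_iff)
  then show ?case using Suc.IH [OF x(2) Suc.prems(2)] x(1) by (auto simp: set_mult_def)
qed

lemma word_ball_mono:
  assumes "\<one> \<in> U" "m \<le> n"
  shows "word_ball G U m \<subseteq> word_ball G U n"
  using assms(2)
proof (rule lift_Suc_mono_le [rotated])
  show "word_ball G U k \<subseteq> word_ball G U (Suc k)" for k
    using assms(1) word_ball_closed [of k] by (force simp: set_mult_def)
qed

lemma word_ball_inv: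
  assumes "\<And>u. u \<in> U \<Longrightarrow> inv u \<in> U"
  shows "x \<in> word_ball G U n \<Longrightarrow> inv x \<in> word_ball G U n"
proof (induction n arbitrary: x)
  case (Suc n)
  then obtain u z where x: "u \<in> U" "z \<in> word_ball G U n" "x = u \<otimes> z" by (auto simp: set_mult_def)
  have "inv x = inv z \<otimes> inv u" using x U word_ball_closed by (auto simp: inv_mult_group subset_iff)
  moreover have "inv z \<otimes> inv u \<in> word_ball G U (n + 1)"
    using Suc.IH [OF x(2)] assms [OF x(1)] word_ball_one by (intro word_ball_mult) auto
  ultimately show ?case by simp
qed simp

end

end

section \<open>Neighbourhoods of the identity and the subgroups that they generate\<close>

context topological_group
begin

lemma openin_carrier: "openin T (carrier G)"
  using openin_topspace [of T] by (simp add: topspace_eq_carrier)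

lemma openin_subset_carrier: "openin T U \<Longrightarrow> U \<subseteq> carrier G"
  using openin_subset topspace_eq_carrier by metis

lemma open_mult_neighbourhood:
  assumes "openin T V" "\<one> \<in> V"
  shows "\<exists>U. openin T U \<and> \<one> \<in> U \<and> (\<forall>x\<in>U. \<forall>y\<in>U. x \<otimes> y \<in> V)"
proof -
  let ?P = "{p \<in> topspace (prod_topology T T). (\<lambda>(x, y). x \<otimes> y) p \<in> V}"
  have "openin (prod_topology T T) ?P" by (rule openin_continuous_map_preimage [OF continuous_mult assms(1)])
  moreover have "(\<one>, \<one>) \<in> ?P" using assms(2) by (simp add: topspace_eq_carrier)
  ultimately obtain A B where "openin T A" "openin T B" "\<one> \<in> A" "\<one> \<in> B" "A \<times> B \<subseteq> ?P"
    unfolding openin_prod_topology_alt by meson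
  then show ?thesis by (intro exI [of _ "A \<inter> B"]) auto
qed

lemma open_word_ball_neighbourhood:
  assumes "openin T V" "\<one> \<in> V"
  shows "\<exists>U. openin T U \<and> \<one> \<in> U \<and> word_ball G U n \<subseteq> V"
  using assms
proof (induction n arbitrary: V)
  case 0
  then show ?case using openin_carrier by auto
next
  case (Suc n)
  obtain W where W: "openin T W" "\<one> \<in> W" "\<forall>x\<in>W. \<forall>y\<in>W. x \<otimes> y \<in> V"
    using open_mult_neighbourhood [OF Suc.prems] by blast
  obtain U where U: "openin T U" "\<one> \<in> U" "word_ball G U n \<subseteq> W"
    using Suc.IH [OF W(1,2)] by blast
  \<comment> \<open>Intersecting with \<open>W\<close> puts the first letter of a longer word into
    \<open>W\<close> as well.\<close>
  have "word_ball G (U \<inter> W) n \<subseteq> W" using word_ball_mono_set [of "U \<inter> W" U n] U(3) by blast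
  then have "word_ball G (U \<inter> W) (Suc n) \<subseteq> V" using W(3) by (auto simp: set_mult_def subset_iff)
  then show ?case using U W by (intro exI [of _ "U \<inter> W"]) auto
qed

text \<open>Take the elements all of whose conjugates lie in the symmetric part of \<open>V\<close>.
  Compactness of the group makes this set open, through \<open>openin_tube\<close>.\<close>

lemma open_invariant_core:
  assumes "compact_space T" "openin T V" "\<one> \<in> V"
  shows "\<exists>U. openin T U \<and> \<one> \<in> U \<and> U \<subseteq> V \<and> (\<forall>u\<in>U. inv u \<in> U) \<and>
    (\<forall>u\<in>U. \<forall>g\<in>carrier G. conj_by G u g \<in> U)"
proof -
  define W where "W = {x \<in> topspace T. x \<in> V \<and> inv x \<in> V}"
  have "W = V \<inter> {x \<in> topspace T. inv x \<in> V}"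
    unfolding W_def using openin_subset [OF assms(2)] by auto
  then have W: "openin T W"
    using assms(2) openin_continuous_map_preimage [OF continuous_inv assms(2)] by auto
  define U where "U = {x \<in> topspace T. \<forall>g\<in>topspace T. (\<lambda>(x, g). conj_by G x g) (x, g) \<in> W}"
  have fs: "continuous_map (prod_topology T T) T fst" "continuous_map (prod_topology T T) T snd"
    by (simp_all add: continuous_map_fst continuous_map_snd)
  have "continuous_map (prod_topology T T) T (\<lambda>p. inv (snd p) \<otimes> fst p \<otimes> snd p)"
    by (intro continuous_map_mult continuous_map_inv fs)
  then have "openin T U"
    unfolding U_def
    by (intro openin_tube [OF assms(1) _ W]) (simp add: conj_by_def case_prod_beta)
  moreover have "\<one> \<in> U" unfolding U_def W_def using assms(3) by (simp add: topspace_eq_carrier)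
  moreover have "U \<subseteq> V"
  proof
    fix u assume "u \<in> U"
    then have u: "u \<in> carrier G" "\<forall>g\<in>carrier G. conj_by G u g \<in> V"
      unfolding U_def W_def by (auto simp: topspace_eq_carrier)
    show "u \<in> V" using bspec [OF u(2) one_closed] u(1) by simp
  qed
  moreover have "inv u \<in> U" if "u \<in> U" for u
    using that unfolding U_def W_def by (auto simp: topspace_eq_carrier conj_by_inv)
  moreover have "conj_by G u g \<in> U" if "u \<in> U" "g \<in> carrier G" for u g
    using that unfolding U_def by (auto simp: topspace_eq_carrier conj_by_conj_by)
  ultimately show ?thesis by blast
qed

lemma openin_generate:
  assumes "openin T U" "\<one> \<in> U"
  shows "openin T (generate G U)"
proof (subst openin_subopen, intro ballI)
  fix h assume h: "h \<in> generate G U"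
  have UG: "U \<subseteq> carrier G" by (rule openin_subset_carrier [OF assms(1)])
  have hG: "h \<in> carrier G" by (rule generate_in_carrier [OF UG h])
  let ?N = "{y \<in> topspace T. inv h \<otimes> y \<in> U}"
  have "openin T ?N"
    using hG by (intro openin_continuous_map_preimage [OF continuous_map_left_mult assms(1)]) simp
  moreover have "h \<in> ?N" using hG assms(2) by (simp add: topspace_eq_carrier)
  moreover have "?N \<subseteq> generate G U"
  proof
    fix y assume y: "y \<in> ?N"
    then have "h \<otimes> (inv h \<otimes> y) \<in> generate G U" by (intro generate.eng [OF h] generate.incl) simp
    then show "y \<in> generate G U" using y hG by (simp add: mult_inv_cancel_left topspace_eq_carrier)
  qed
  ultimately show "\<exists>N. openin T N \<and> h \<in> N \<and> N \<subseteq> generate G U" by blast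
qed

lemma normal_generate_invariant:
  assumes U: "U \<subseteq> carrier G" and inv: "\<And>u g. u \<in> U \<Longrightarrow> g \<in> carrier G \<Longrightarrow> conj_by G u g \<in> U"
  shows "generate G U \<lhd> G"
proof -
  have "conj_by G h g \<in> generate G U" if h: "h \<in> generate G U" and g: "g \<in> carrier G" for h g
    using h
  proof induction
    case one then show ?case using g by (simp add: generate.one)
  next
    case (incl u) then show ?case using inv g by (intro generate.incl)
  next
    case (inv u)
    then have "conj_by G (inv u) g = inv (conj_by G u g)" using U g by (auto intro!: conj_by_inv)
    then show ?case using generate.inv [OF assms(2) [OF inv g]] by simp
  next
    case (eng h k)
    then have "conj_by G (h \<otimes> k) g = conj_by G h g \<otimes> conj_by G k g"
      using generate_in_carrier [OF U] g by (intro conj_by_mult)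
    then show ?case using generate.eng [OF eng.IH] by simp
  qed
  \<comment> \<open>\<open>normal_inv_iff\<close> conjugates in the opposite direction, hence the
    inverse.\<close>
  from this [OF _ inv_closed] show ?thesis
    using generate_is_subgroup [OF U] unfolding normal_inv_iff by (simp add: conj_by_def)
qed

end

section \<open>The open normal 2-Engel subgroup\<close>

text \<open>Inverses and commutators of the restricted structure agree with those of
  \<open>G\<close>, so the criterion for a group generated by \<open>U\<close> carries over.\<close>

lemma (in group) two_engel_subgroup_generate:
  assumes U: "U \<subseteq> carrier G"
    and sym: "\<And>u. u \<in> U \<Longrightarrow> inv u \<in> U"
    and engel: "\<And>x b. x \<in> U \<Longrightarrow> b \<in> U \<Longrightarrow> commutator G (commutator G x b) b = \<one>"
    and swap: "\<And>x b c. x \<in> U \<Longrightarrow> b \<in> U \<Longrightarrow> c \<in> U \<Longrightarrow>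
      commutator G (commutator G x b) c \<otimes> commutator G (commutator G x c) b = \<one>"
    and nilp: "\<And>x b c d. x \<in> U \<Longrightarrow> b \<in> U \<Longrightarrow> c \<in> U \<Longrightarrow> d \<in> U \<Longrightarrow>
      commutator G (commutator G (commutator G x b) c) d = \<one>"
  shows "two_engel (G\<lparr>carrier := generate G U\<rparr>)"
proof -
  let ?H = "G\<lparr>carrier := generate G U\<rparr>"
  have sub: "subgroup (generate G U) G" by (rule generate_is_subgroup [OF U])
  interpret H: group ?H by (rule subgroup_imp_group [OF sub])
  have inv: "inv\<^bsub>?H\<^esub> x = inv x" if "x \<in> generate G U" for x
    by (rule m_inv_consistent [OF sub that])
  have cm: "commutator ?H x y = commutator G x y" if "x \<in> generate G U" "y \<in> generate G U" for x y
    using that by (simp add: commutator_def inv)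
  have cm_mem: "commutator G x y \<in> generate G U" if "x \<in> generate G U" "y \<in> generate G U" for x y
    unfolding commutator_def using that subgroup.m_inv_closed [OF sub] by (intro generate.eng)
  have incl: "u \<in> generate G U" if "u \<in> U" for u using that by (rule generate.incl)
  have "commutator ?H (commutator ?H g h) h = \<one>\<^bsub>?H\<^esub>" if "g \<in> carrier ?H" "h \<in> carrier ?H" for g h
  proof (rule H.two_engel_generate [where U = U, OF _ _ _ _ _ that])
    show "carrier ?H = generate ?H U"
      using generate_consistent [OF subsetI [OF incl] sub] by simp
  qed (use sym engel swap nilp in \<open>simp_all add: inv cm cm_mem incl\<close>)
  then show ?thesis unfolding two_engel_def using H.group_axioms by blast
qed

theorem theorem4p4:
  fixes G :: "('a, 'b) monoid_scheme"
    and T :: "'a topology"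
    and M :: "'a measure"
    and \<alpha> :: "'a \<Rightarrow> 'a"
    and S :: "'a set"
  assumes "topological_group G T"
    and "compact_space T"
    and "Hausdorff_space T"
    and "normalized_haar_measure G T M"
    and "\<alpha> \<in> iso G G"
    and "\<forall>x\<in>carrier G. \<alpha> (\<alpha> (\<alpha> x)) = x"
    and "S = {x \<in> carrier G. \<alpha> (\<alpha> x) \<otimes>\<^bsub>G\<^esub> \<alpha> x \<otimes>\<^bsub>G\<^esub> x = \<one>\<^bsub>G\<^esub>}"
    and "S \<in> sets (completion M)"
    and "emeasure (completion M) S > 0"
  shows "\<exists>N. N \<lhd> G \<and> openin T N \<and> two_engel (G\<lparr>carrier := N\<rparr>)"
proof -
  interpret topological_group G T by fact
  have \<alpha>: "\<alpha> \<in> hom G G" using assms(5) by (simp add: iso_def)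
  have S: "x \<in> S \<longleftrightarrow> x \<in> carrier G \<and> splits_at \<alpha> x" for x
    unfolding assms(7) splits_at_def by simp
  obtain V where V: "openin T V" "\<one>\<^bsub>G\<^esub> \<in> V"
    and translates: "\<And>W. finite W \<Longrightarrow> card W \<le> 8 \<Longrightarrow> W \<subseteq> V \<Longrightarrow>
      \<exists>x\<in>carrier G. \<forall>w\<in>W. inv\<^bsub>G\<^esub> w \<otimes>\<^bsub>G\<^esub> x \<in> S"
    using haar_positive_translates [OF assms(2-4,8,9), of 8] by blast
  \<comment> \<open>The set contains the inverses of the eight words, since a translate by w
    provides \<open>inv w\<close> times a common element.\<close>
  have commute: "a \<otimes>\<^bsub>G\<^esub> conj_by G a b = conj_by G a b \<otimes>\<^bsub>G\<^esub> a"
    if "a \<in> carrier G" "b \<in> carrier G"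
      and F: "{\<one>\<^bsub>G\<^esub>, inv\<^bsub>G\<^esub> a, inv\<^bsub>G\<^esub> b, b, inv\<^bsub>G\<^esub> b \<otimes>\<^bsub>G\<^esub> inv\<^bsub>G\<^esub> a, inv\<^bsub>G\<^esub> b \<otimes>\<^bsub>G\<^esub> a,
        inv\<^bsub>G\<^esub> a \<otimes>\<^bsub>G\<^esub> b, a \<otimes>\<^bsub>G\<^esub> b} \<subseteq> V" (is "?F \<subseteq> V")
    for a b
  proof -
    have "card ?F \<le> 8" by (intro card_insert_le_m1) simp_all
    then obtain x where x: "x \<in> carrier G" "\<And>w. w \<in> ?F \<Longrightarrow> inv\<^bsub>G\<^esub> w \<otimes>\<^bsub>G\<^esub> x \<in> S"
      using translates [OF _ _ F] by (meson finite.emptyI finite.insertI)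
    \<comment> \<open>The word 1 puts \<open>x\<close> itself into \<open>S\<close>, so \<alpha> can
      be twisted by \<open>x\<close>; the other words become the splitting equations of the twisted
      map.\<close>
    have "splits_at \<alpha> x" using x(2) [of "\<one>\<^bsub>G\<^esub>"] x(1) by (simp add: S)
    note L = twist_left [OF \<alpha> assms(6) x(1) this]
    let ?\<theta> = "\<lambda>g. \<alpha> (conj_by G g x)"
    have split: "splits_at ?\<theta> (inv\<^bsub>G\<^esub> w)" if "w \<in> ?F" for w
    proof (rule L(3))
      show "inv\<^bsub>G\<^esub> w \<in> carrier G" using that \<open>a \<in> carrier G\<close> \<open>b \<in> carrier G\<close> by auto
      show "splits_at \<alpha> (inv\<^bsub>G\<^esub> w \<otimes>\<^bsub>G\<^esub> x)" using x(2) [OF that] S by blast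
    qed
    show ?thesis
    proof (rule splits_at_commute_conj [OF L(1,2) that(1,2)])
      show "splits_at ?\<theta> a" using split [of "inv\<^bsub>G\<^esub> a"] that(1) by simp
      show "splits_at ?\<theta> b" using split [of "inv\<^bsub>G\<^esub> b"] that(2) by simp
      show "splits_at ?\<theta> (inv\<^bsub>G\<^esub> b)" using split [of b] by simp
      show "splits_at ?\<theta> (a \<otimes>\<^bsub>G\<^esub> b)"
        using split [of "inv\<^bsub>G\<^esub> b \<otimes>\<^bsub>G\<^esub> inv\<^bsub>G\<^esub> a"] that(1,2) by (simp add: inv_mult_group)
      show "splits_at ?\<theta> (inv\<^bsub>G\<^esub> a \<otimes>\<^bsub>G\<^esub> b)"
        using split [of "inv\<^bsub>G\<^esub> b \<otimes>\<^bsub>G\<^esub> a"] that(1,2) by (simp add: inv_mult_group)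
      show "splits_at ?\<theta> (inv\<^bsub>G\<^esub> b \<otimes>\<^bsub>G\<^esub> a)"
        using split [of "inv\<^bsub>G\<^esub> a \<otimes>\<^bsub>G\<^esub> b"] that(1,2) by (simp add: inv_mult_group)
      show "splits_at ?\<theta> (inv\<^bsub>G\<^esub> b \<otimes>\<^bsub>G\<^esub> inv\<^bsub>G\<^esub> a)"
        using split [of "a \<otimes>\<^bsub>G\<^esub> b"] that(1,2) by (simp add: inv_mult_group)
    qed
  qed
  \<comment> \<open>The eight words are products of at most two elements of length 16, hence
    32.\<close>
  obtain V' where V': "openin T V'" "\<one>\<^bsub>G\<^esub> \<in> V'" "word_ball G V' 32 \<subseteq> V"
    using open_word_ball_neighbourhood [OF V] by blast
  \<comment> \<open>Symmetry closes the word balls under inverses, and invariance makes the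
    generated subgroup normal.\<close>
  obtain U where U: "openin T U" "\<one>\<^bsub>G\<^esub> \<in> U" "U \<subseteq> V'"
    and U_inv: "\<And>u. u \<in> U \<Longrightarrow> inv\<^bsub>G\<^esub> u \<in> U"
    and U_conj: "\<And>u g. u \<in> U \<Longrightarrow> g \<in> carrier G \<Longrightarrow> conj_by G u g \<in> U"
    using open_invariant_core [OF assms(2) V'(1,2)] by blast
  have UG: "U \<subseteq> carrier G" by (rule openin_subset_carrier [OF U(1)])
  have UV: "word_ball G U 32 \<subseteq> V" using word_ball_mono_set [OF U(3)] V'(3) by blast
  interpret E: engel_filtration G "word_ball G U"
  proof
    show "word_ball G U n \<subseteq> carrier G" for n by (rule word_ball_closed [OF UG])
    show mono: "word_ball G U m \<subseteq> word_ball G U n" if "m \<le> n" for m n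
      by (rule word_ball_mono [OF UG U(2) that])
    show mult: "x \<otimes>\<^bsub>G\<^esub> y \<in> word_ball G U (m + n)"
      if "x \<in> word_ball G U m" "y \<in> word_ball G U n" for m n x y
      by (rule word_ball_mult [OF UG that])
    show inv: "inv\<^bsub>G\<^esub> x \<in> word_ball G U n" if "x \<in> word_ball G U n" for n x
      by (rule word_ball_inv [OF UG U_inv that])
    show "\<one>\<^bsub>G\<^esub> \<in> word_ball G U 0" by simp
    fix a b assume ab: "a \<in> word_ball G U 16" "b \<in> word_ball G U 16"
    show "a \<otimes>\<^bsub>G\<^esub> conj_by G a b = conj_by G a b \<otimes>\<^bsub>G\<^esub> a"
    proof (rule commute)
      show "a \<in> carrier G" "b \<in> carrier G" using ab word_ball_closed [OF UG] by auto
      have long: "x \<in> V" if "x \<in> word_ball G U 16" for x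
        using mono [of 16 32] that UV by auto
      have prod: "x \<otimes>\<^bsub>G\<^esub> y \<in> V" if "x \<in> word_ball G U 16" "y \<in> word_ball G U 16" for x y
        using mult [OF that] UV by auto
      show "{\<one>\<^bsub>G\<^esub>, inv\<^bsub>G\<^esub> a, inv\<^bsub>G\<^esub> b, b, inv\<^bsub>G\<^esub> b \<otimes>\<^bsub>G\<^esub> inv\<^bsub>G\<^esub> a, inv\<^bsub>G\<^esub> b \<otimes>\<^bsub>G\<^esub> a,
        inv\<^bsub>G\<^esub> a \<otimes>\<^bsub>G\<^esub> b, a \<otimes>\<^bsub>G\<^esub> b} \<subseteq> V"
        using V(2) long prod inv [OF ab(1)] inv [OF ab(2)] ab by simp
    qed
  qed
  have U1: "u \<in> word_ball G U 1" if "u \<in> U" for u using that word_ball_one [OF UG] by simp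
  have U4: "u \<in> word_ball G U 4" if "u \<in> U" for u using E.filt_le [OF U1 [OF that]] by simp
  have U16: "u \<in> word_ball G U 16" if "u \<in> U" for u using E.filt_le [OF U1 [OF that]] by simp
  have "two_engel (G\<lparr>carrier := generate G U\<rparr>)"
  proof (rule two_engel_subgroup_generate [OF UG U_inv])
    show "commutator G (commutator G x b) b = \<one>\<^bsub>G\<^esub>" if "x \<in> U" "b \<in> U" for x b
      using E.engel [OF U16 U16, OF that] that UG by (subst commutator_eq_one_iff) auto
  qed (simp_all add: E.triple_commutator_swap_right U4 E.quadruple_commutator_eq_one [OF U1 U1 U1 U1])
  then show ?thesis
    using normal_generate_invariant [OF UG U_conj] openin_generate [OF U(1,2)] by blast
qed

end
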